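(* Let $A$ be a finite dimensional algebra over a field and let $(\mathcal C,\mathcal T,\mathcal F)$ be an lw-cotorsion-torsion triple in $\mathrm{mod}\,A$. Then there is an equivalence of categories $$\mathcal C/(\mathcal C\cap\mathcal T)\simeq\mathcal F .$$
   Context: $\mathrm{mod}\,A$ is the category of finite dimensional left $A$-modules. All subcategories are full and closed under isomorphisms. $\mathcal C/(\mathcal C\cap\mathcal T)$ is the quotient of $\mathcal C$ by the ideal of morphisms factoring through objects of $\mathcal C\cap\mathcal T$. A pair $(\mathcal C,\mathcal T)$ of subcategories of $\mathrm{mod}\,A$ is a left weak cotorsion pair (lw-cotorsion pair) if: (1) $\mathrm{Ext}^1_A(C,T')=0$ for all $C\in\mathcal C$, $T'\in\mathcal T$; and (2) for every $M\in\mathrm{mod}\,A$ there are exact sequences $$0\to Y_M\to X_M\xrightarrow{f_M}M\to 0\quad\text{and}\quad M\xrightarrow{g^M}Y^M\to X^M\to 0$$ with $X_M,X^M\in\mathcal C$, $Y_M,Y^M\in\mathcal T$, where $f_M$ is a right $\mathcal C$-approximation of $M$ (every map $C\to M$ with $C\in\mathcal C$ factors through $f_M$) and $g^M$ is a left $\mathcal T$-approximation of $M$ (every map $M\to T'$ with $T'\in\mathcal T$ factors through $g^M$). A triple $(\mathcal C,\mathcal T,\mathcal F)$ of subcategories is an lw-cotorsion-torsion triple if $(\mathcal C,\mathcal T)$ is an lw-cotorsion pair and $(\mathcal T,\mathcal F)$ is a torsion pair in $\mathrm{mod}\,A$. *)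

theory Defs
  imports "HOL-Algebra.Module" "HOL-Library.FuncSet" "Jordan_Normal_Form.Missing_VectorSpace"
begin

section \<open>Finite dimensional algebras and their finite dimensional left modules\<close>

text \<open>The library locale \<open>algebra\<close> is about commutative algebras only, and the library locale
  \<open>module\<close> is about modules over commutative rings.  An algebra below is unital and associative,
  not necessarily commutative; the record field \<open>smult\<close> of \<open>A\<close> is the action of the field \<open>K\<close>.\<close>

locale fd_algebra = vectorspace K A + A?: ring A
  for K :: "('k, 'y) ring_scheme" and A :: "('k, 'a, 'z) module_scheme" (structure) +
  assumes smult_mult_left:
      "\<lbrakk>c \<in> carrier K; x \<in> carrier A; y \<in> carrier A\<rbrakk> \<Longrightarrow> (c \<odot> x) \<otimes> y = c \<odot> (x \<otimes> y)"
    and smult_mult_right: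
      "\<lbrakk>c \<in> carrier K; x \<in> carrier A; y \<in> carrier A\<rbrakk> \<Longrightarrow> x \<otimes> (c \<odot> y) = c \<odot> (x \<otimes> y)"
    and fin_dim_algebra: "vectorspace.fin_dim K A"

text \<open>Modules use the library record \<open>module\<close>; its inherited fields \<open>mult\<close> and \<open>one\<close>
  are irrelevant and unconstrained.\<close>

locale left_module = R?: ring R + M?: abelian_group M
  for R :: "('a, 'y) ring_scheme" (structure) and M :: "('a, 'm, 'z) module_scheme" (structure) +
  assumes act_closed:
      "\<lbrakk>a \<in> carrier R; x \<in> carrier M\<rbrakk> \<Longrightarrow> a \<odot>\<^bsub>M\<^esub> x \<in> carrier M"
    and act_l_distr:
      "\<lbrakk>a \<in> carrier R; b \<in> carrier R; x \<in> carrier M\<rbrakk>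
        \<Longrightarrow> (a \<oplus> b) \<odot>\<^bsub>M\<^esub> x = a \<odot>\<^bsub>M\<^esub> x \<oplus>\<^bsub>M\<^esub> b \<odot>\<^bsub>M\<^esub> x"
    and act_r_distr:
      "\<lbrakk>a \<in> carrier R; x \<in> carrier M; y \<in> carrier M\<rbrakk>
        \<Longrightarrow> a \<odot>\<^bsub>M\<^esub> (x \<oplus>\<^bsub>M\<^esub> y) = a \<odot>\<^bsub>M\<^esub> x \<oplus>\<^bsub>M\<^esub> a \<odot>\<^bsub>M\<^esub> y"
    and act_assoc:
      "\<lbrakk>a \<in> carrier R; b \<in> carrier R; x \<in> carrier M\<rbrakk>
        \<Longrightarrow> (a \<otimes> b) \<odot>\<^bsub>M\<^esub> x = a \<odot>\<^bsub>M\<^esub> (b \<odot>\<^bsub>M\<^esub> x)"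
    and act_one: "x \<in> carrier M \<Longrightarrow> \<one> \<odot>\<^bsub>M\<^esub> x = x"

definition restrict_scalars :: "('k, 'a) module \<Rightarrow> ('a, 'm) module \<Rightarrow> ('k, 'm) module" where
  "restrict_scalars A M =
    \<lparr>carrier = carrier M, monoid.mult = monoid.mult M, one = one M, zero = zero M, add = add M,
     smult = (\<lambda>c x. (c \<odot>\<^bsub>A\<^esub> \<one>\<^bsub>A\<^esub>) \<odot>\<^bsub>M\<^esub> x)\<rparr>"

text \<open>The objects of mod A whose underlying set is a subset of the type \<open>'m\<close>.  As soon as the lists
  over \<open>carrier K\<close> embed into \<open>'m\<close> (that is, \<open>'m\<close> is infinite and at least as large as \<open>K\<close>), there is
  room for every power of \<open>K\<close>, so every finite dimensional module is isomorphic to one of these.\<close>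

definition fd_modules :: "'k ring \<Rightarrow> ('k, 'a) module \<Rightarrow> ('a, 'm) module set" where
  "fd_modules K A = {M. left_module A M \<and> vectorspace.fin_dim K (restrict_scalars A M)}"

text \<open>Homomorphisms are \<open>undefined\<close> outside of the source, so that equality of morphisms
  is equality of functions.\<close>

definition Hom :: "('k, 'a) module \<Rightarrow> ('a, 'm) module \<Rightarrow> ('a, 'm) module \<Rightarrow> ('m \<Rightarrow> 'm) set" where
  "Hom A M N = module_hom A M N \<inter> extensional (carrier M)"

definition isomorphic :: "('k, 'a) module \<Rightarrow> ('a, 'm) module \<Rightarrow> ('a, 'm) module \<Rightarrow> bool" where
  "isomorphic A M N \<longleftrightarrow> (\<exists>f\<in>Hom A M N. bij_betw f (carrier M) (carrier N))"

definition ker :: "('a, 'm) module \<Rightarrow> ('a, 'm) module \<Rightarrow> ('m \<Rightarrow> 'm) \<Rightarrow> 'm set" where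
  "ker M N f = {x \<in> carrier M. f x = \<zero>\<^bsub>N\<^esub>}"

text \<open>Exactness of \<open>X \<rightarrow> Y \<rightarrow> Z \<rightarrow> 0\<close> and of \<open>0 \<rightarrow> X \<rightarrow> Y \<rightarrow> Z \<rightarrow> 0\<close>.\<close>

definition right_exact_seq ::
    "('k, 'a) module \<Rightarrow> ('a, 'm) module \<Rightarrow> ('m \<Rightarrow> 'm) \<Rightarrow> ('a, 'm) module \<Rightarrow> ('m \<Rightarrow> 'm)
      \<Rightarrow> ('a, 'm) module \<Rightarrow> bool" where
  "right_exact_seq A X f Y g Z \<longleftrightarrow>
     f \<in> Hom A X Y \<and> g \<in> Hom A Y Z \<and> f ` carrier X = ker Y Z g \<and> g ` carrier Y = carrier Z"

definition short_exact_seq ::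
    "('k, 'a) module \<Rightarrow> ('a, 'm) module \<Rightarrow> ('m \<Rightarrow> 'm) \<Rightarrow> ('a, 'm) module \<Rightarrow> ('m \<Rightarrow> 'm)
      \<Rightarrow> ('a, 'm) module \<Rightarrow> bool" where
  "short_exact_seq A X f Y g Z \<longleftrightarrow> right_exact_seq A X f Y g Z \<and> inj_on f (carrier X)"

text \<open>A full subcategory of mod A closed under isomorphisms is given by its set of objects.\<close>

definition iso_closed_subcategory ::
    "'k ring \<Rightarrow> ('k, 'a) module \<Rightarrow> ('a, 'm) module set \<Rightarrow> bool" where
  "iso_closed_subcategory K A S \<longleftrightarrow> S \<subseteq> fd_modules K A \<and>
     (\<forall>M\<in>S. \<forall>N\<in>fd_modules K A. isomorphic A M N \<longrightarrow> N \<in> S)"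


section \<open>The first extension group (Yoneda)\<close>

text \<open>Extensions \<open>0 \<rightarrow> T \<rightarrow> E \<rightarrow> C \<rightarrow> 0\<close> in mod A, and their equivalence.\<close>

definition extensions ::
    "'k ring \<Rightarrow> ('k, 'a) module \<Rightarrow> ('a, 'm) module \<Rightarrow> ('a, 'm) module
      \<Rightarrow> (('a, 'm) module \<times> ('m \<Rightarrow> 'm) \<times> ('m \<Rightarrow> 'm)) set" where
  "extensions K A C T = {(E, i, p). E \<in> fd_modules K A \<and> short_exact_seq A T i E p C}"

definition extension_equiv ::
    "'k ring \<Rightarrow> ('k, 'a) module \<Rightarrow> ('a, 'm) module \<Rightarrow> ('a, 'm) module
      \<Rightarrow> (('a, 'm) module \<times> ('m \<Rightarrow> 'm) \<times> ('m \<Rightarrow> 'm)) rel" where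
  "extension_equiv K A C T =
     {((E, i, p), (E', i', p')).
        (E, i, p) \<in> extensions K A C T \<and> (E', i', p') \<in> extensions K A C T \<and>
        (\<exists>h\<in>Hom A E E'. bij_betw h (carrier E) (carrier E') \<and>
           (\<forall>t\<in>carrier T. h (i t) = i' t) \<and> (\<forall>e\<in>carrier E. p' (h e) = p e))}"

definition Ext1 ::
    "'k ring \<Rightarrow> ('k, 'a) module \<Rightarrow> ('a, 'm) module \<Rightarrow> ('a, 'm) module
      \<Rightarrow> (('a, 'm) module \<times> ('m \<Rightarrow> 'm) \<times> ('m \<Rightarrow> 'm)) set set" where
  "Ext1 K A C T = extensions K A C T // extension_equiv K A C T"

text \<open>The zero element of \<open>Ext1 K A C T\<close> is the class of the split extensions.\<close>

definition Ext1_zero ::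
    "'k ring \<Rightarrow> ('k, 'a) module \<Rightarrow> ('a, 'm) module \<Rightarrow> ('a, 'm) module
      \<Rightarrow> (('a, 'm) module \<times> ('m \<Rightarrow> 'm) \<times> ('m \<Rightarrow> 'm)) set" where
  "Ext1_zero K A C T =
     {(E, i, p) \<in> extensions K A C T. \<exists>s\<in>Hom A C E. \<forall>c\<in>carrier C. p (s c) = c}"


section \<open>Cotorsion pairs and torsion pairs\<close>

definition right_approximation ::
    "('k, 'a) module \<Rightarrow> ('a, 'm) module set \<Rightarrow> ('a, 'm) module \<Rightarrow> ('a, 'm) module
      \<Rightarrow> ('m \<Rightarrow> 'm) \<Rightarrow> bool" where
  "right_approximation A \<C> X M f \<longleftrightarrow> X \<in> \<C> \<and> f \<in> Hom A X M \<and>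
     (\<forall>C\<in>\<C>. \<forall>h\<in>Hom A C M. \<exists>u\<in>Hom A C X. h = compose (carrier C) f u)"

definition left_approximation ::
    "('k, 'a) module \<Rightarrow> ('a, 'm) module set \<Rightarrow> ('a, 'm) module \<Rightarrow> ('a, 'm) module
      \<Rightarrow> ('m \<Rightarrow> 'm) \<Rightarrow> bool" where
  "left_approximation A \<T> M Y g \<longleftrightarrow> Y \<in> \<T> \<and> g \<in> Hom A M Y \<and>
     (\<forall>T\<in>\<T>. \<forall>h\<in>Hom A M T. \<exists>u\<in>Hom A Y T. h = compose (carrier M) u g)"

definition lw_cotorsion_pair ::
    "'k ring \<Rightarrow> ('k, 'a) module \<Rightarrow> ('a, 'm) module set \<Rightarrow> ('a, 'm) module set \<Rightarrow> bool" where
  "lw_cotorsion_pair K A \<C> \<T> \<longleftrightarrow>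
     iso_closed_subcategory K A \<C> \<and> iso_closed_subcategory K A \<T> \<and>
     (\<forall>C\<in>\<C>. \<forall>T\<in>\<T>. Ext1 K A C T = {Ext1_zero K A C T}) \<and>
     (\<forall>M\<in>fd_modules K A.
        (\<exists>Y\<in>\<T>. \<exists>X\<in>\<C>. \<exists>j f. short_exact_seq A Y j X f M \<and> right_approximation A \<C> X M f) \<and>
        (\<exists>Y\<in>\<T>. \<exists>X\<in>\<C>. \<exists>g q. right_exact_seq A M g Y q X \<and> left_approximation A \<T> M Y g))"

definition Hom_vanishes ::
    "('k, 'a) module \<Rightarrow> ('a, 'm) module \<Rightarrow> ('a, 'm) module \<Rightarrow> bool" where
  "Hom_vanishes A M N \<longleftrightarrow> Hom A M N = {\<lambda>x\<in>carrier M. \<zero>\<^bsub>N\<^esub>}"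

definition torsion_pair ::
    "'k ring \<Rightarrow> ('k, 'a) module \<Rightarrow> ('a, 'm) module set \<Rightarrow> ('a, 'm) module set \<Rightarrow> bool" where
  "torsion_pair K A \<T> \<F> \<longleftrightarrow>
     \<T> = {M \<in> fd_modules K A. \<forall>F\<in>\<F>. Hom_vanishes A M F} \<and>
     \<F> = {N \<in> fd_modules K A. \<forall>T\<in>\<T>. Hom_vanishes A T N}"

definition lw_cotorsion_torsion_triple ::
    "'k ring \<Rightarrow> ('k, 'a) module \<Rightarrow> ('a, 'm) module set \<Rightarrow> ('a, 'm) module set
      \<Rightarrow> ('a, 'm) module set \<Rightarrow> bool" where
  "lw_cotorsion_torsion_triple K A \<C> \<T> \<F> \<longleftrightarrow>
     lw_cotorsion_pair K A \<C> \<T> \<and> torsion_pair K A \<T> \<F>"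


section \<open>Categories and equivalences\<close>

text \<open>Hom-sets need not be disjoint; \<open>Comp C X Y Z g f\<close> is the composite of \<open>f : X \<rightarrow> Y\<close>
  and \<open>g : Y \<rightarrow> Z\<close>.\<close>

record ('o, 'f) cat =
  Obj :: "'o set"
  Mor :: "'o \<Rightarrow> 'o \<Rightarrow> 'f set"
  Ident :: "'o \<Rightarrow> 'f"
  Comp :: "'o \<Rightarrow> 'o \<Rightarrow> 'o \<Rightarrow> 'f \<Rightarrow> 'f \<Rightarrow> 'f"

locale category =
  fixes C :: "('o, 'f) cat"
  assumes ident_closed: "X \<in> Obj C \<Longrightarrow> Ident C X \<in> Mor C X X"
    and comp_closed:
      "\<lbrakk>X \<in> Obj C; Y \<in> Obj C; Z \<in> Obj C; f \<in> Mor C X Y; g \<in> Mor C Y Z\<rbrakk>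
        \<Longrightarrow> Comp C X Y Z g f \<in> Mor C X Z"
    and comp_ident_right:
      "\<lbrakk>X \<in> Obj C; Y \<in> Obj C; f \<in> Mor C X Y\<rbrakk> \<Longrightarrow> Comp C X X Y f (Ident C X) = f"
    and comp_ident_left:
      "\<lbrakk>X \<in> Obj C; Y \<in> Obj C; f \<in> Mor C X Y\<rbrakk> \<Longrightarrow> Comp C X Y Y (Ident C Y) f = f"
    and comp_assoc:
      "\<lbrakk>W \<in> Obj C; X \<in> Obj C; Y \<in> Obj C; Z \<in> Obj C;
        f \<in> Mor C W X; g \<in> Mor C X Y; h \<in> Mor C Y Z\<rbrakk>
        \<Longrightarrow> Comp C W X Z (Comp C X Y Z h g) f = Comp C W Y Z h (Comp C W X Y g f)"

record ('o, 'f, 'p, 'g) func =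
  on_obj :: "'o \<Rightarrow> 'p"
  on_mor :: "'o \<Rightarrow> 'o \<Rightarrow> 'f \<Rightarrow> 'g"

definition is_functor ::
    "('o, 'f) cat \<Rightarrow> ('p, 'g) cat \<Rightarrow> ('o, 'f, 'p, 'g) func \<Rightarrow> bool" where
  "is_functor C D F \<longleftrightarrow>
     (\<forall>X\<in>Obj C. on_obj F X \<in> Obj D) \<and>
     (\<forall>X\<in>Obj C. \<forall>Y\<in>Obj C. \<forall>f\<in>Mor C X Y. on_mor F X Y f \<in> Mor D (on_obj F X) (on_obj F Y)) \<and>
     (\<forall>X\<in>Obj C. on_mor F X X (Ident C X) = Ident D (on_obj F X)) \<and>
     (\<forall>X\<in>Obj C. \<forall>Y\<in>Obj C. \<forall>Z\<in>Obj C. \<forall>f\<in>Mor C X Y. \<forall>g\<in>Mor C Y Z.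
        on_mor F X Z (Comp C X Y Z g f) =
          Comp D (on_obj F X) (on_obj F Y) (on_obj F Z) (on_mor F Y Z g) (on_mor F X Y f))"

definition id_func :: "('o, 'f, 'o, 'f) func" where
  "id_func = \<lparr>on_obj = (\<lambda>X. X), on_mor = (\<lambda>X Y f. f)\<rparr>"

definition comp_func ::
    "('p, 'g, 'q, 'h) func \<Rightarrow> ('o, 'f, 'p, 'g) func \<Rightarrow> ('o, 'f, 'q, 'h) func" where
  "comp_func G F =
     \<lparr>on_obj = (\<lambda>X. on_obj G (on_obj F X)),
      on_mor = (\<lambda>X Y f. on_mor G (on_obj F X) (on_obj F Y) (on_mor F X Y f))\<rparr>"

definition is_iso :: "('o, 'f) cat \<Rightarrow> 'o \<Rightarrow> 'o \<Rightarrow> 'f \<Rightarrow> bool" where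
  "is_iso C X Y f \<longleftrightarrow> f \<in> Mor C X Y \<and>
     (\<exists>g\<in>Mor C Y X. Comp C X Y X g f = Ident C X \<and> Comp C Y X Y f g = Ident C Y)"

definition naturally_isomorphic ::
    "('o, 'f) cat \<Rightarrow> ('p, 'g) cat \<Rightarrow> ('o, 'f, 'p, 'g) func \<Rightarrow> ('o, 'f, 'p, 'g) func \<Rightarrow> bool" where
  "naturally_isomorphic C D F G \<longleftrightarrow>
     (\<exists>\<eta>. (\<forall>X\<in>Obj C. is_iso D (on_obj F X) (on_obj G X) (\<eta> X)) \<and>
        (\<forall>X\<in>Obj C. \<forall>Y\<in>Obj C. \<forall>f\<in>Mor C X Y.
           Comp D (on_obj F X) (on_obj F Y) (on_obj G Y) (\<eta> Y) (on_mor F X Y f) =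
           Comp D (on_obj F X) (on_obj G X) (on_obj G Y) (on_mor G X Y f) (\<eta> X)))"

definition equivalent_categories :: "('o, 'f) cat \<Rightarrow> ('p, 'g) cat \<Rightarrow> bool" where
  "equivalent_categories C D \<longleftrightarrow> category C \<and> category D \<and>
     (\<exists>F G. is_functor C D F \<and> is_functor D C G \<and>
        naturally_isomorphic C C (comp_func G F) id_func \<and>
        naturally_isomorphic D D (comp_func F G) id_func)"


section \<open>Full subcategories of mod A and their quotients\<close>

definition full_subcat ::
    "('k, 'a) module \<Rightarrow> ('a, 'm) module set \<Rightarrow> (('a, 'm) module, 'm \<Rightarrow> 'm) cat" where
  "full_subcat A S =
     \<lparr>Obj = S, Mor = Hom A, Ident = (\<lambda>X. \<lambda>x\<in>carrier X. x),
      Comp = (\<lambda>X Y Z g f. compose (carrier X) g f)\<rparr>"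

definition factor_through ::
    "('k, 'a) module \<Rightarrow> ('a, 'm) module set \<Rightarrow> ('a, 'm) module \<Rightarrow> ('a, 'm) module
      \<Rightarrow> ('m \<Rightarrow> 'm) set" where
  "factor_through A W X Y =
     {f. \<exists>Z\<in>W. \<exists>u\<in>Hom A X Z. \<exists>v\<in>Hom A Z Y. f = compose (carrier X) v u}"

definition factor_rel ::
    "('k, 'a) module \<Rightarrow> ('a, 'm) module set \<Rightarrow> ('a, 'm) module \<Rightarrow> ('a, 'm) module
      \<Rightarrow> ('m \<Rightarrow> 'm) rel" where
  "factor_rel A W X Y =
     {(f, g). f \<in> Hom A X Y \<and> g \<in> Hom A X Y \<and>
        (\<lambda>x\<in>carrier X. f x \<ominus>\<^bsub>Y\<^esub> g x) \<in> factor_through A W X Y}"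

text \<open>The quotient of the full subcategory on \<open>S\<close> by the morphisms that factor through an object
  of \<open>W\<close>.  Composition is that of representatives: if those morphisms form an ideal, the union
  below is over one and the same class.\<close>

definition quotient_cat ::
    "('k, 'a) module \<Rightarrow> ('a, 'm) module set \<Rightarrow> ('a, 'm) module set
      \<Rightarrow> (('a, 'm) module, ('m \<Rightarrow> 'm) set) cat" where
  "quotient_cat A S W =
     \<lparr>Obj = S,
      Mor = (\<lambda>X Y. Hom A X Y // factor_rel A W X Y),
      Ident = (\<lambda>X. factor_rel A W X X `` {\<lambda>x\<in>carrier X. x}),
      Comp = (\<lambda>X Y Z \<beta> \<alpha>. \<Union>g\<in>\<beta>. \<Union>f\<in>\<alpha>. factor_rel A W X Z `` {compose (carrier X) g f})\<rparr>"


section \<open>Well-definedness checks\<close>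

lemma left_module_vectorspace:
  fixes K :: "'k ring" and A :: "('k, 'a) module" and M :: "('a, 'm) module"
  assumes "fd_algebra K A" and "left_module A M"
  shows "vectorspace K (restrict_scalars A M)"
proof -
  interpret fd_algebra K A by fact
  interpret M: left_module A M by fact
  have ag: "abelian_group (restrict_scalars A M)"
  proof (rule abelian_groupI)
    fix x assume "x \<in> carrier (restrict_scalars A M)"
    then show "\<exists>y\<in>carrier (restrict_scalars A M). y \<oplus>\<^bsub>restrict_scalars A M\<^esub> x = \<zero>\<^bsub>restrict_scalars A M\<^esub>"
      by (auto simp: restrict_scalars_def intro: bexI[where x="\<ominus>\<^bsub>M\<^esub> x"] M.M.l_neg)
  qed (auto simp: restrict_scalars_def M.M.a_assoc M.M.a_comm M.M.a_lcomm)
  have "module K (restrict_scalars A M)"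
  proof (rule moduleI[OF _ ag])
    show "cring K" by (rule R.is_cring)
    fix a b x assume ab: "a \<in> carrier K" "b \<in> carrier K" and x: "x \<in> carrier (restrict_scalars A M)"
    have "(a \<otimes>\<^bsub>K\<^esub> b) \<odot>\<^bsub>A\<^esub> \<one>\<^bsub>A\<^esub> = (a \<odot>\<^bsub>A\<^esub> \<one>\<^bsub>A\<^esub>) \<otimes>\<^bsub>A\<^esub> (b \<odot>\<^bsub>A\<^esub> \<one>\<^bsub>A\<^esub>)"
      using ab by (simp add: smult_mult_left smult_assoc1)
    then show "(a \<otimes>\<^bsub>K\<^esub> b) \<odot>\<^bsub>restrict_scalars A M\<^esub> x
        = a \<odot>\<^bsub>restrict_scalars A M\<^esub> (b \<odot>\<^bsub>restrict_scalars A M\<^esub> x)"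
      using ab x by (simp add: restrict_scalars_def M.act_assoc)
  qed (auto simp: restrict_scalars_def M.act_closed M.act_r_distr M.act_one smult_l_distr
      M.act_l_distr)
  then show ?thesis by (intro vectorspace.intro field_axioms)
qed

lemma category_full_subcat:
  assumes "S \<subseteq> fd_modules K A"
  shows "category (full_subcat A S)"
proof -
  have act: "a \<odot>\<^bsub>X\<^esub> x \<in> carrier X" if "X \<in> S" "x \<in> carrier X" "a \<in> carrier A" for X x a
  proof -
    interpret left_module A X using assms that(1) by (auto simp: fd_modules_def)
    show ?thesis using that by (simp add: act_closed)
  qed
  have add: "x \<oplus>\<^bsub>X\<^esub> y \<in> carrier X" if "X \<in> S" "x \<in> carrier X" "y \<in> carrier X" for X x y
  proof -
    interpret left_module A X using assms that(1) by (auto simp: fd_modules_def)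
    show ?thesis using that by simp
  qed
  show ?thesis
    by unfold_locales
      (auto simp: full_subcat_def Hom_def module_hom_def compose_def Pi_def extensional_def
          restrict_def fun_eq_iff act add)
qed

end

theory Submission
  imports Defs
begin

text \<open>
  Every module \<open>M\<close> has a canonical sequence \<open>0 \<rightarrow> tM \<rightarrow> M \<rightarrow> M/tM \<rightarrow> 0\<close> with \<open>tM\<close> in \<open>\<T>\<close> and \<open>M/tM\<close> in
  \<open>\<F>\<close> (\<open>canonical_torsion_sequence\<close>).  The equivalence is induced by the functor from \<open>\<C>\<close> to \<open>\<F>\<close> that
  sends \<open>X\<close> to \<open>X/tX\<close>.  Three facts make it one.

  It is full (\<open>quot_map_surj\<close>): given \<open>X/tX \<rightarrow> Y/tY\<close> with \<open>X\<close> and \<open>Y\<close> in \<open>\<C>\<close>, the composite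
  \<open>X \<rightarrow> X/tX \<rightarrow> Y/tY\<close> lifts to a map \<open>X \<rightarrow> Y\<close>, because \<open>Ext\<^sup>1(X, tY) = 0\<close>.

  Its kernel is the ideal of the morphisms that factor through \<open>\<C> \<inter> \<T>\<close> (\<open>factor_rel_eq_kernel\<close>).  A
  morphism \<open>X \<rightarrow> Y\<close> that becomes zero lands in \<open>tY\<close>.  Since \<open>X\<close> is in \<open>\<C>\<close>, it factors through the
  right \<open>\<C>\<close>-approximation \<open>Z \<rightarrow> tY\<close>; and \<open>Z\<close>, being an extension of \<open>tY\<close> by a module in \<open>\<T>\<close>, is in
  \<open>\<T>\<close> as well.  The converse holds because every map from \<open>\<T>\<close> to \<open>\<F>\<close> is zero.

  It is dense (\<open>quot_iso_if_torsion_kernel\<close>): the right \<open>\<C>\<close>-approximation \<open>X \<rightarrow> F\<close> of \<open>F\<close> in \<open>\<F>\<close> is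
  a surjection with kernel in \<open>\<T>\<close>, so its kernel is \<open>tX\<close> and \<open>F\<close> is isomorphic to \<open>X/tX\<close>.

  A full and dense functor is an equivalence modulo its kernel
  (\<open>equivalent_if_quotient_by_kernel\<close>).  The hypothesis on \<open>\<iota>\<close> makes \<open>'m\<close> infinite, which leaves room
  for the pullbacks that realise the obstruction to lifting.
\<close>

section \<open>Homomorphisms of modules\<close>

lemma (in left_module) act_zero:
  assumes "a \<in> carrier R"
  shows "a \<odot>\<^bsub>M\<^esub> \<zero>\<^bsub>M\<^esub> = \<zero>\<^bsub>M\<^esub>"
proof -
  have "a \<odot>\<^bsub>M\<^esub> \<zero>\<^bsub>M\<^esub> \<oplus>\<^bsub>M\<^esub> a \<odot>\<^bsub>M\<^esub> \<zero>\<^bsub>M\<^esub> = a \<odot>\<^bsub>M\<^esub> \<zero>\<^bsub>M\<^esub>"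
    using act_r_distr[OF assms, of "\<zero>\<^bsub>M\<^esub>" "\<zero>\<^bsub>M\<^esub>"] by simp
  then show ?thesis using act_closed[OF assms] by simp
qed

lemma HomI:
  assumes "f \<in> extensional (carrier M)"
    and "\<And>x. x \<in> carrier M \<Longrightarrow> f x \<in> carrier N"
    and "\<And>x y. \<lbrakk>x \<in> carrier M; y \<in> carrier M\<rbrakk> \<Longrightarrow> f (x \<oplus>\<^bsub>M\<^esub> y) = f x \<oplus>\<^bsub>N\<^esub> f y"
    and "\<And>a x. \<lbrakk>a \<in> carrier A; x \<in> carrier M\<rbrakk> \<Longrightarrow> f (a \<odot>\<^bsub>M\<^esub> x) = a \<odot>\<^bsub>N\<^esub> f x"
  shows "f \<in> Hom A M N"
  using assms by (auto simp: Hom_def module_hom_def)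

lemma module_hom_restrict_in_Hom:
  assumes "left_module A M" and "f \<in> module_hom A M N"
  shows "restrict f (carrier M) \<in> Hom A M N"
proof -
  interpret left_module A M by fact
  show ?thesis using assms(2) by (auto simp: Hom_def module_hom_def act_closed)
qed

lemma
  assumes "f \<in> Hom A M N"
  shows Hom_closed: "x \<in> carrier M \<Longrightarrow> f x \<in> carrier N"
    and Hom_add: "\<lbrakk>x \<in> carrier M; y \<in> carrier M\<rbrakk> \<Longrightarrow> f (x \<oplus>\<^bsub>M\<^esub> y) = f x \<oplus>\<^bsub>N\<^esub> f y"
    and Hom_act: "\<lbrakk>a \<in> carrier A; x \<in> carrier M\<rbrakk> \<Longrightarrow> f (a \<odot>\<^bsub>M\<^esub> x) = a \<odot>\<^bsub>N\<^esub> f x"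
  using assms by (auto simp: Hom_def module_hom_def)

lemma Hom_eqI:
  assumes "f \<in> Hom A M N" "g \<in> Hom A M N" "\<And>x. x \<in> carrier M \<Longrightarrow> f x = g x"
  shows "f = g"
  using assms by (auto simp: Hom_def intro: extensionalityI)

lemma Hom_zero_apply:
  assumes "left_module A M" "left_module A N" "f \<in> Hom A M N"
  shows "f \<zero>\<^bsub>M\<^esub> = \<zero>\<^bsub>N\<^esub>"
proof -
  interpret M: left_module A M by fact
  interpret N: left_module A N by fact
  have "f \<zero>\<^bsub>M\<^esub> \<oplus>\<^bsub>N\<^esub> f \<zero>\<^bsub>M\<^esub> = f \<zero>\<^bsub>M\<^esub>"
    using Hom_add[OF assms(3), of "\<zero>\<^bsub>M\<^esub>" "\<zero>\<^bsub>M\<^esub>"] by simp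
  then show ?thesis using Hom_closed[OF assms(3)] by simp
qed

lemma Hom_minus:
  assumes "left_module A M" "left_module A N" "f \<in> Hom A M N" "x \<in> carrier M" "y \<in> carrier M"
  shows "f (x \<ominus>\<^bsub>M\<^esub> y) = f x \<ominus>\<^bsub>N\<^esub> f y"
proof -
  interpret M: left_module A M by fact
  interpret N: left_module A N by fact
  have "f x = f ((x \<ominus>\<^bsub>M\<^esub> y) \<oplus>\<^bsub>M\<^esub> y)"
    using assms by (simp add: M.M.minus_eq M.M.a_assoc M.M.l_neg)
  also have "\<dots> = f (x \<ominus>\<^bsub>M\<^esub> y) \<oplus>\<^bsub>N\<^esub> f y"
    using assms by (intro Hom_add[OF assms(3)]) auto
  finally show ?thesis
    using assms by (simp add: Hom_closed N.M.minus_eq N.M.a_assoc N.M.r_neg)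
qed

lemma (in abelian_group) minus_eq_zero_iff:
  assumes "x \<in> carrier G" "y \<in> carrier G"
  shows "x \<ominus> y = \<zero> \<longleftrightarrow> x = y"
  using assms by (metis minus_eq a_inv_closed minus_equality minus_minus r_neg)

lemma Hom_eq_iff_minus_in_ker:
  assumes "left_module A M" "left_module A N" "f \<in> Hom A M N" "x \<in> carrier M" "y \<in> carrier M"
  shows "f x = f y \<longleftrightarrow> x \<ominus>\<^bsub>M\<^esub> y \<in> ker M N f"
proof -
  interpret M: left_module A M by fact
  interpret N: left_module A N by fact
  show ?thesis
    using assms by (simp add: ker_def Hom_minus Hom_closed N.M.minus_eq_zero_iff)
qed

lemma id_in_Hom: "left_module A M \<Longrightarrow> (\<lambda>x\<in>carrier M. x) \<in> Hom A M M"
  using module_hom_restrict_in_Hom[of A M "\<lambda>x. x" M] by (auto simp: module_hom_def)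

lemma compose_in_Hom:
  assumes "left_module A L" "f \<in> Hom A L M" "g \<in> Hom A M N"
  shows "compose (carrier L) g f \<in> Hom A L N"
proof -
  interpret left_module A L by fact
  show ?thesis using assms(2,3)
    by (auto simp: Hom_def module_hom_def compose_def act_closed Pi_def)
qed

lemma zero_in_Hom:
  assumes "left_module A M" "left_module A N"
  shows "(\<lambda>x\<in>carrier M. \<zero>\<^bsub>N\<^esub>) \<in> Hom A M N"
proof -
  interpret M: left_module A M by fact
  interpret N: left_module A N by fact
  show ?thesis by (intro HomI) (auto simp: M.act_closed N.act_zero)
qed

lemma minus_in_Hom:
  assumes "left_module A M" "left_module A N" "f \<in> Hom A M N" "g \<in> Hom A M N"
  shows "(\<lambda>x\<in>carrier M. f x \<ominus>\<^bsub>N\<^esub> g x) \<in> Hom A M N"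
proof -
  interpret M: left_module A M by fact
  interpret N: left_module A N by fact
  note cl = Hom_closed[OF assms(3)] Hom_closed[OF assms(4)]
  have neg: "a \<odot>\<^bsub>N\<^esub> (\<ominus>\<^bsub>N\<^esub> y) = \<ominus>\<^bsub>N\<^esub> (a \<odot>\<^bsub>N\<^esub> y)" if "a \<in> carrier A" "y \<in> carrier N" for a y
  proof -
    have "a \<odot>\<^bsub>N\<^esub> (\<ominus>\<^bsub>N\<^esub> y) \<oplus>\<^bsub>N\<^esub> a \<odot>\<^bsub>N\<^esub> y = a \<odot>\<^bsub>N\<^esub> \<zero>\<^bsub>N\<^esub>"
      using N.act_r_distr[of a "\<ominus>\<^bsub>N\<^esub> y" y] that by (simp add: N.M.l_neg)
    then show ?thesis using that N.M.minus_equality N.act_zero by (simp add: N.act_closed)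
  qed
  show ?thesis
  proof (rule HomI)
    fix x y assume "x \<in> carrier M" "y \<in> carrier M"
    then show "(\<lambda>x\<in>carrier M. f x \<ominus>\<^bsub>N\<^esub> g x) (x \<oplus>\<^bsub>M\<^esub> y)
      = (\<lambda>x\<in>carrier M. f x \<ominus>\<^bsub>N\<^esub> g x) x \<oplus>\<^bsub>N\<^esub> (\<lambda>x\<in>carrier M. f x \<ominus>\<^bsub>N\<^esub> g x) y"
      by (simp add: Hom_add[OF assms(3)] Hom_add[OF assms(4)] cl N.M.minus_eq N.M.minus_add N.M.a_ac)
  next
    fix a x assume "a \<in> carrier A" "x \<in> carrier M"
    then show "(\<lambda>x\<in>carrier M. f x \<ominus>\<^bsub>N\<^esub> g x) (a \<odot>\<^bsub>M\<^esub> x)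
      = a \<odot>\<^bsub>N\<^esub> (\<lambda>x\<in>carrier M. f x \<ominus>\<^bsub>N\<^esub> g x) x"
      by (simp add: Hom_act[OF assms(3)] Hom_act[OF assms(4)] cl N.M.minus_eq M.act_closed
          N.act_closed N.act_r_distr neg)
  qed (auto simp: cl)
qed

lemma Hom_factors_through_surjection:
  assumes "left_module A M" "left_module A Q" "left_module A N"
    and p: "p \<in> Hom A M Q" "p ` carrier M = carrier Q"
    and g: "g \<in> Hom A M N" and sub: "ker M Q p \<subseteq> ker M N g"
  obtains h where "h \<in> Hom A Q N" and "\<And>x. x \<in> carrier M \<Longrightarrow> h (p x) = g x"
proof -
  interpret M: left_module A M by fact
  interpret Q: left_module A Q by fact
  have wd: "g x = g y" if "x \<in> carrier M" "y \<in> carrier M" "p x = p y" for x y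
    using that assms Hom_eq_iff_minus_in_ker[OF assms(1,2) p(1)]
      Hom_eq_iff_minus_in_ker[OF assms(1,3) g] by blast
  define h where "h = (\<lambda>y\<in>carrier Q. g (inv_into (carrier M) p y))"
  have hp: "h (p x) = g x" if "x \<in> carrier M" for x
  proof -
    have "p x \<in> p ` carrier M" using that by blast
    then have "inv_into (carrier M) p (p x) \<in> carrier M" "p (inv_into (carrier M) p (p x)) = p x"
      by (auto intro: inv_into_into f_inv_into_f)
    then have "g (inv_into (carrier M) p (p x)) = g x" using that by (intro wd)
    then show ?thesis using that Hom_closed[OF p(1)] by (simp add: h_def)
  qed
  have "h \<in> Hom A Q N"
  proof (rule HomI)
    show "h \<in> extensional (carrier Q)" by (simp add: h_def)
    fix y assume "y \<in> carrier Q"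
    then obtain x where x: "x \<in> carrier M" "y = p x" using p(2) by auto
    show "h y \<in> carrier N" using x hp Hom_closed[OF g] by simp
    fix a assume a: "a \<in> carrier A"
    show "h (a \<odot>\<^bsub>Q\<^esub> y) = a \<odot>\<^bsub>N\<^esub> h y"
      using x a hp hp[OF M.act_closed[OF a x(1)]] by (simp add: Hom_act[OF p(1)] Hom_act[OF g])
  next
    fix y z assume "y \<in> carrier Q" "z \<in> carrier Q"
    then obtain u v where x: "u \<in> carrier M" "y = p u" "v \<in> carrier M" "z = p v"
      using p(2) by blast
    show "h (y \<oplus>\<^bsub>Q\<^esub> z) = h y \<oplus>\<^bsub>N\<^esub> h z"
      using x hp hp[of "u \<oplus>\<^bsub>M\<^esub> v"] by (simp add: Hom_add[OF p(1)] Hom_add[OF g])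
  qed
  then show thesis using hp that by blast
qed

lemma Hom_factors_through_injection:
  assumes "left_module A X" "left_module A T"
    and i: "i \<in> Hom A T M" "inj_on i (carrier T)"
    and g: "g \<in> Hom A X M" and sub: "g ` carrier X \<subseteq> i ` carrier T"
  obtains h where "h \<in> Hom A X T" and "\<And>x. x \<in> carrier X \<Longrightarrow> i (h x) = g x"
proof -
  interpret X: left_module A X by fact
  interpret T: left_module A T by fact
  define h where "h = (\<lambda>x\<in>carrier X. inv_into (carrier T) i (g x))"
  have h: "h x \<in> carrier T" "i (h x) = g x" if "x \<in> carrier X" for x
    using that sub by (auto simp: h_def intro!: inv_into_into f_inv_into_f)
  have inj: "s = t" if "i s = i t" "s \<in> carrier T" "t \<in> carrier T" for s t
    using i(2) that by (auto dest: inj_onD)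
  have "h \<in> Hom A X T"
  proof (rule HomI)
    show "h \<in> extensional (carrier X)" by (simp add: h_def)
    show "h (x \<oplus>\<^bsub>X\<^esub> y) = h x \<oplus>\<^bsub>T\<^esub> h y" if "x \<in> carrier X" "y \<in> carrier X" for x y
      by (rule inj) (use that in \<open>simp_all add: h Hom_add[OF i(1)] Hom_add[OF g]\<close>)
    show "h (a \<odot>\<^bsub>X\<^esub> x) = a \<odot>\<^bsub>T\<^esub> h x" if "a \<in> carrier A" "x \<in> carrier X" for a x
      by (rule inj)
        (use that in \<open>simp_all add: h X.act_closed T.act_closed Hom_act[OF i(1)] Hom_act[OF g]\<close>)
  qed (auto simp: h)
  then show thesis using h that by blast
qed

section \<open>Submodules, images and direct sums\<close>

definition left_submodule ::
    "('k, 'a) module \<Rightarrow> 'x set \<Rightarrow> ('a, 'x) module \<Rightarrow> bool" where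
  "left_submodule A N M \<longleftrightarrow> N \<subseteq> carrier M \<and> \<zero>\<^bsub>M\<^esub> \<in> N \<and>
    (\<forall>x\<in>N. \<forall>y\<in>N. x \<oplus>\<^bsub>M\<^esub> y \<in> N) \<and> (\<forall>a\<in>carrier A. \<forall>x\<in>N. a \<odot>\<^bsub>M\<^esub> x \<in> N)"

text \<open>Submodules are closed under negation because it is the action of a scalar.\<close>

lemma (in left_module) act_minus_one:
  assumes "x \<in> carrier M"
  shows "(\<ominus> \<one>) \<odot>\<^bsub>M\<^esub> x = \<ominus>\<^bsub>M\<^esub> x"
proof -
  have z: "\<zero> \<odot>\<^bsub>M\<^esub> x = \<zero>\<^bsub>M\<^esub>"
  proof -
    have "\<zero> \<odot>\<^bsub>M\<^esub> x \<oplus>\<^bsub>M\<^esub> \<zero> \<odot>\<^bsub>M\<^esub> x = \<zero> \<odot>\<^bsub>M\<^esub> x"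
      using act_l_distr[of \<zero> \<zero> x] assms by simp
    then show ?thesis using act_closed[of \<zero> x] assms by simp
  qed
  have "(\<ominus> \<one>) \<odot>\<^bsub>M\<^esub> x \<oplus>\<^bsub>M\<^esub> x = \<zero>\<^bsub>M\<^esub>"
    using act_l_distr[of "\<ominus> \<one>" \<one> x] assms z by (simp add: act_one R.l_neg)
  then show ?thesis using act_closed[of "\<ominus> \<one>" x] assms M.minus_equality by simp
qed

lemma left_module_submodule:
  assumes "left_module A M" "left_submodule A N M"
  shows "left_module A (M\<lparr>carrier := N\<rparr>)"
proof -
  interpret left_module A M by fact
  have N: "x \<in> N \<Longrightarrow> x \<in> carrier M" for x using assms(2) by (auto simp: left_submodule_def)
  have cl: "\<zero>\<^bsub>M\<^esub> \<in> N" "\<And>x y. \<lbrakk>x \<in> N; y \<in> N\<rbrakk> \<Longrightarrow> x \<oplus>\<^bsub>M\<^esub> y \<in> N"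
    "\<And>a x. \<lbrakk>a \<in> carrier A; x \<in> N\<rbrakk> \<Longrightarrow> a \<odot>\<^bsub>M\<^esub> x \<in> N"
    using assms(2) by (auto simp: left_submodule_def)
  have neg: "\<ominus>\<^bsub>M\<^esub> x \<in> N" if "x \<in> N" for x
    using cl(3)[OF _ that, of "\<ominus>\<^bsub>A\<^esub> \<one>\<^bsub>A\<^esub>"] act_minus_one[OF N[OF that]] by simp
  have "abelian_group (M\<lparr>carrier := N\<rparr>)"
  proof (rule abelian_groupI)
    fix x assume "x \<in> carrier (M\<lparr>carrier := N\<rparr>)"
    then show "\<exists>y\<in>carrier (M\<lparr>carrier := N\<rparr>). y \<oplus>\<^bsub>M\<lparr>carrier := N\<rparr>\<^esub> x = \<zero>\<^bsub>M\<lparr>carrier := N\<rparr>\<^esub>"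
      using neg N by (intro bexI[of _ "\<ominus>\<^bsub>M\<^esub> x"]) (simp_all add: M.l_neg)
  qed (simp_all add: N cl M.a_ac)
  then show ?thesis
    by (intro left_module.intro left_module_axioms.intro R.ring_axioms)
      (simp_all add: N cl act_l_distr act_r_distr act_assoc act_one)
qed

lemma left_submodule_ker:
  assumes "left_module A M" "left_module A N" "f \<in> Hom A M N"
  shows "left_submodule A (ker M N f) M"
proof -
  interpret M: left_module A M by fact
  interpret N: left_module A N by fact
  show ?thesis
    using Hom_zero_apply[OF assms]
    by (simp add: left_submodule_def ker_def subset_iff Hom_add[OF assms(3)] Hom_act[OF assms(3)]
        M.act_closed N.act_zero)
qed

text \<open>The transport of structure along \<open>r\<close>, which yields modules whose elements lie in a prescribed
  type.  Two maps \<open>r\<close> occur below: the choice of representatives modulo a submodule, where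
  \<open>image_module\<close> is the quotient, and an injection of pairs into \<open>'m\<close>, where it is an isomorphic
  copy of a module of pairs.\<close>

definition image_module :: "('a, 'x) module \<Rightarrow> ('x \<Rightarrow> 'm) \<Rightarrow> ('a, 'm) module" where
  "image_module P r =
    \<lparr>carrier = r ` carrier P, monoid.mult = undefined, one = undefined, zero = r \<zero>\<^bsub>P\<^esub>,
     add = (\<lambda>s t. r (inv_into (carrier P) r s \<oplus>\<^bsub>P\<^esub> inv_into (carrier P) r t)),
     smult = (\<lambda>a s. r (a \<odot>\<^bsub>P\<^esub> inv_into (carrier P) r s))\<rparr>"

definition respects_operations ::
    "('k, 'a) module \<Rightarrow> ('a, 'x) module \<Rightarrow> ('x \<Rightarrow> 'm) \<Rightarrow> bool" where
  "respects_operations A P r \<longleftrightarrow>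
    (\<forall>x\<in>carrier P. \<forall>x'\<in>carrier P. \<forall>y\<in>carrier P. \<forall>y'\<in>carrier P.
       r x = r x' \<longrightarrow> r y = r y' \<longrightarrow> r (x \<oplus>\<^bsub>P\<^esub> y) = r (x' \<oplus>\<^bsub>P\<^esub> y')) \<and>
    (\<forall>a\<in>carrier A. \<forall>x\<in>carrier P. \<forall>x'\<in>carrier P. r x = r x' \<longrightarrow> r (a \<odot>\<^bsub>P\<^esub> x) = r (a \<odot>\<^bsub>P\<^esub> x'))"

lemma image_module_hom:
  assumes "respects_operations A P r"
  shows "r \<in> module_hom A P (image_module P r)"
proof -
  have "inv_into (carrier P) r (r x) \<in> carrier P" "r (inv_into (carrier P) r (r x)) = r x"
    if "x \<in> carrier P" for x using that by (auto intro: inv_into_into f_inv_into_f)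
  then show ?thesis
    using assms by (auto simp: module_hom_def image_module_def respects_operations_def)
qed

lemma left_module_image_module:
  assumes "left_module A P" "respects_operations A P r"
  shows "left_module A (image_module P r)" (is "left_module A ?N")
proof -
  interpret left_module A P by fact
  note hom = image_module_hom[OF assms(2)]
  have add: "r x \<oplus>\<^bsub>?N\<^esub> r y = r (x \<oplus>\<^bsub>P\<^esub> y)" if "x \<in> carrier P" "y \<in> carrier P" for x y
    using hom that by (simp add: module_hom_def)
  have act: "a \<odot>\<^bsub>?N\<^esub> r x = r (a \<odot>\<^bsub>P\<^esub> x)" if "a \<in> carrier A" "x \<in> carrier P" for a x
    using hom that by (simp add: module_hom_def)
  have car: "carrier ?N = r ` carrier P" and zero: "\<zero>\<^bsub>?N\<^esub> = r \<zero>\<^bsub>P\<^esub>" by (auto simp: image_module_def)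
  have "abelian_group ?N"
  proof (rule abelian_groupI)
    fix x assume "x \<in> carrier ?N"
    then obtain u where "u \<in> carrier P" "x = r u" by (auto simp: car)
    then show "\<exists>y\<in>carrier ?N. y \<oplus>\<^bsub>?N\<^esub> x = \<zero>\<^bsub>?N\<^esub>"
      using add[of "\<ominus>\<^bsub>P\<^esub> u" u] by (auto simp: car zero M.l_neg)
  qed (auto simp: car zero add M.a_ac)
  then show ?thesis
    by (intro left_module.intro left_module_axioms.intro R.ring_axioms)
      (auto simp: car add act act_closed act_l_distr act_r_distr act_assoc act_one)
qed

lemma left_module_direct_sum:
  assumes "left_module A M" "left_module A N"
  shows "left_module A (direct_sum M N)"
proof -
  interpret M: left_module A M by fact
  interpret N: left_module A N by fact
  have "abelian_group (direct_sum M N)"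
  proof (rule abelian_groupI)
    fix x assume "x \<in> carrier (direct_sum M N)"
    then show "\<exists>y\<in>carrier (direct_sum M N). y \<oplus>\<^bsub>direct_sum M N\<^esub> x = \<zero>\<^bsub>direct_sum M N\<^esub>"
      by (intro bexI[where x="(\<ominus>\<^bsub>M\<^esub> fst x, \<ominus>\<^bsub>N\<^esub> snd x)"])
        (auto simp: direct_sum_def M.M.l_neg N.M.l_neg)
  qed (auto simp: direct_sum_def M.M.a_ac N.M.a_ac)
  then show ?thesis
    by (intro left_module.intro left_module_axioms.intro M.R.ring_axioms)
      (auto simp: direct_sum_def M.act_closed M.act_l_distr M.act_r_distr M.act_assoc M.act_one
         N.act_closed N.act_l_distr N.act_r_distr N.act_assoc N.act_one)
qed

section \<open>Finite dimensional modules\<close>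

lemma linear_map_restrict_scalars:
  fixes K :: "'k ring" and A :: "('k, 'a) module"
  assumes "fd_algebra K A" "left_module A M" "left_module A N" "f \<in> module_hom A M N"
  shows "linear_map K (restrict_scalars A M) (restrict_scalars A N) f"
proof -
  interpret fd_algebra K A by fact
  interpret VM: vectorspace K "restrict_scalars A M" by (rule left_module_vectorspace[OF assms(1,2)])
  interpret VN: vectorspace K "restrict_scalars A N" by (rule left_module_vectorspace[OF assms(1,3)])
  have "f \<in> module_hom K (restrict_scalars A M) (restrict_scalars A N)"
    using assms(4) by (auto simp: module_hom_def restrict_scalars_def)
  then show ?thesis by unfold_locales
qed

text \<open>A linearly independent subset of \<open>W\<close> of the largest possible size exists because the dimension of
  \<open>V\<close> bounds all these sizes.  It is maximal, so it generates \<open>W\<close>.\<close>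

lemma (in vectorspace) fin_dim_subspace:
  assumes "fin_dim" "subspace K W V"
  shows "vectorspace.fin_dim K (vs W)"
proof -
  interpret W: vectorspace K "vs W" by (rule subspace_is_vs[OF assms(2)])
  have sub: "submodule K W V" and WV: "W \<subseteq> carrier V"
    using assms(2) by (auto simp: subspace_def submodule_def)
  have ind: "W.lin_dep S = lin_dep S" if "S \<subseteq> W" for S
    using span_li_not_depend(2)[OF that sub] .
  let ?P = "\<lambda>S. S \<subseteq> W \<and> lin_indpt S"
  have bd: "finite S \<and> card S \<le> dim" if "?P S" for S
    using that li_le_dim[OF assms(1)] WV by auto
  have "?P {}" by (auto simp: lin_dep_def)
  then obtain S where S: "?P S" "\<And>T. ?P T \<Longrightarrow> card T \<le> card S"
    using ex_has_greatest_nat[of ?P "{}" card "Suc dim"] bd le_imp_less_Suc by blast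
  have "maximal S (\<lambda>S. S \<subseteq> carrier (vs W) \<and> W.lin_indpt S)"
    unfolding maximal_def using S bd ind by (metis card_seteq carrier_vs_is_self)
  then have "W.gen_set S" by (rule W.max_li_is_gen)
  then show ?thesis using S bd unfolding W.fin_dim_def by auto
qed

text \<open>The images of generators of \<open>U\<close> together with preimages of generators of \<open>W\<close> generate \<open>V\<close>.\<close>

lemma fin_dim_extension:
  assumes "linear_map K U V i" "linear_map K V W p"
    and exact: "\<And>v. v \<in> carrier V \<Longrightarrow> p v = \<zero>\<^bsub>W\<^esub> \<Longrightarrow> v \<in> i ` carrier U"
    and surj: "p ` carrier V = carrier W"
    and "vectorspace.fin_dim K U" "vectorspace.fin_dim K W"
  shows "vectorspace.fin_dim K V"
proof -
  interpret U: vectorspace K U using assms(1) by (simp add: linear_map_def)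
  interpret V: vectorspace K V using assms(1) by (simp add: linear_map_def)
  interpret W: vectorspace K W using assms(2) by (simp add: linear_map_def)
  interpret i: linear_map K U V i by fact
  interpret p: linear_map K V W p by fact
  obtain S where S: "finite S" "S \<subseteq> carrier U" "U.span S = carrier U"
    using assms(5) unfolding U.fin_dim_def by auto
  obtain T where T: "finite T" "T \<subseteq> carrier W" "W.span T = carrier W"
    using assms(6) unfolding W.fin_dim_def by auto
  obtain T' where T': "finite T'" "T' \<subseteq> carrier V" "T = p ` T'"
    using finite_subset_image[of T p "carrier V"] T surj by metis
  define G where "G = i ` S \<union> T'"
  have G: "finite G" "G \<subseteq> carrier V"
    using S T' by (auto simp: G_def)
  define N where "N = V.span G"
  have N: "submodule K N V" unfolding N_def by (rule V.span_is_submodule[OF G(2)])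
  then have NV: "N \<subseteq> carrier V" by (simp add: submodule_def)
  have GN: "G \<subseteq> N" unfolding N_def by (rule V.in_own_span[OF G(2)])
  note cl = submodule.m_closed[OF N] submodule.zero_closed[OF N] submodule.smult_closed[OF N]
  have "submodule K {u \<in> carrier U. i u \<in> N} U"
    by unfold_locales (auto simp: cl)
  then have "U.span S \<subseteq> {u \<in> carrier U. i u \<in> N}"
    using S GN by (intro U.span_is_subset) (auto simp: G_def)
  then have iN: "i ` carrier U \<subseteq> N" using S by auto
  have "submodule K (p ` N) W"
  proof unfold_locales
    show "p ` N \<subseteq> carrier W" using NV by auto
    show "\<zero>\<^bsub>W\<^esub> \<in> p ` N" using cl(2) p.f0_is_0 by (metis imageI)
    fix v w assume "v \<in> p ` N" "w \<in> p ` N"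
    then obtain a b where "a \<in> N" "b \<in> N" "v = p a" "w = p b" by auto
    then show "v \<oplus>\<^bsub>W\<^esub> w \<in> p ` N"
      using NV cl(1)[of a b] p.f_add[of a b] by (metis imageI subsetD)
  next
    fix c v assume "c \<in> carrier K" "v \<in> p ` N"
    then obtain a where "a \<in> N" "v = p a" by auto
    then show "c \<odot>\<^bsub>W\<^esub> v \<in> p ` N"
      using NV cl(3)[of c a] p.f_smult[of c a] \<open>c \<in> carrier K\<close> by (metis imageI subsetD)
  qed
  then have "W.span T \<subseteq> p ` N"
    using GN T' by (intro W.span_is_subset) (auto simp: G_def)
  then have pN: "carrier W \<subseteq> p ` N" using T by simp
  have "carrier V \<subseteq> N"
  proof
    fix v assume v: "v \<in> carrier V"
    then obtain n where n: "n \<in> N" "p v = p n" using pN p.f_im by blast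
    then have nV: "n \<in> carrier V" using NV by auto
    have "p (v \<ominus>\<^bsub>V\<^esub> n) = \<zero>\<^bsub>W\<^esub>"
      using v nV n p.f_minus[of v n] by (simp add: W.M.minus_eq W.M.r_neg)
    then have "v \<ominus>\<^bsub>V\<^esub> n \<in> N" using exact[of "v \<ominus>\<^bsub>V\<^esub> n"] v nV iN by auto
    then have "(v \<ominus>\<^bsub>V\<^esub> n) \<oplus>\<^bsub>V\<^esub> n \<in> N" using n cl by simp
    then show "v \<in> N"
      using v nV by (simp add: V.M.minus_eq V.M.a_assoc V.M.l_neg)
  qed
  then show ?thesis using NV G unfolding V.fin_dim_def N_def by blast
qed

lemma fd_modules_submodule:
  fixes K :: "'k ring" and A :: "('k, 'a) module" and M :: "('a, 'm) module"
  assumes "fd_algebra K A" "M \<in> fd_modules K A" "left_submodule A N M"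
  shows "M\<lparr>carrier := N\<rparr> \<in> fd_modules K A"
proof -
  interpret fd_algebra K A by fact
  have M: "left_module A M" "vectorspace.fin_dim K (restrict_scalars A M)"
    using assms(2) by (auto simp: fd_modules_def)
  interpret V: vectorspace K "restrict_scalars A M" by (rule left_module_vectorspace[OF assms(1) M(1)])
  have "subspace K N (restrict_scalars A M)"
    using assms(3) by unfold_locales (auto simp: left_submodule_def restrict_scalars_def)
  from V.fin_dim_subspace[OF M(2) this]
  have "vectorspace.fin_dim K (restrict_scalars A (M\<lparr>carrier := N\<rparr>))"
    by (simp add: restrict_scalars_def)
  then show ?thesis using left_module_submodule[OF M(1) assms(3)] by (simp add: fd_modules_def)
qed

lemma fd_modules_image:
  fixes K :: "'k ring" and A :: "('k, 'a) module"
  assumes "fd_algebra K A" "M \<in> fd_modules K A" "left_module A N"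
    and "f \<in> module_hom A M N" "f ` carrier M = carrier N"
  shows "N \<in> fd_modules K A"
proof -
  have M: "left_module A M" "vectorspace.fin_dim K (restrict_scalars A M)"
    using assms(2) by (auto simp: fd_modules_def)
  interpret linear_map K "restrict_scalars A M" "restrict_scalars A N" f
    by (rule linear_map_restrict_scalars[OF assms(1) M(1) assms(3,4)])
  show ?thesis
    using surj_fin_dim[OF M(2)] assms(3,5) by (simp add: fd_modules_def restrict_scalars_def)
qed

lemma fd_modules_extension:
  fixes K :: "'k ring" and A :: "('k, 'a) module"
  assumes "fd_algebra K A" "L \<in> fd_modules K A" "N \<in> fd_modules K A" "left_module A M"
    and "i \<in> module_hom A L M" "p \<in> module_hom A M N"
    and "\<And>x. x \<in> carrier M \<Longrightarrow> p x = \<zero>\<^bsub>N\<^esub> \<Longrightarrow> x \<in> i ` carrier L"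
    and "p ` carrier M = carrier N"
  shows "M \<in> fd_modules K A"
proof -
  have L: "left_module A L" "vectorspace.fin_dim K (restrict_scalars A L)"
    and N: "left_module A N" "vectorspace.fin_dim K (restrict_scalars A N)"
    using assms(2,3) by (auto simp: fd_modules_def)
  have "vectorspace.fin_dim K (restrict_scalars A M)"
    by (rule fin_dim_extension[OF linear_map_restrict_scalars[OF assms(1) L(1) assms(4,5)]
          linear_map_restrict_scalars[OF assms(1,4) N(1) assms(6)] _ _ L(2) N(2)])
      (use assms(7,8) in \<open>auto simp: restrict_scalars_def\<close>)
  then show ?thesis using assms(4) by (simp add: fd_modules_def)
qed

section \<open>Torsion pairs and the canonical sequence\<close>

lemma fd_modulesD: "M \<in> fd_modules K A \<Longrightarrow> left_module A M"
  by (simp add: fd_modules_def)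

lemma Hom_vanishesI:
  assumes "left_module A M" "left_module A N"
    and "\<And>h x. \<lbrakk>h \<in> Hom A M N; x \<in> carrier M\<rbrakk> \<Longrightarrow> h x = \<zero>\<^bsub>N\<^esub>"
  shows "Hom_vanishes A M N"
  unfolding Hom_vanishes_def
proof (intro equalityI subsetI)
  show "h \<in> {\<lambda>x\<in>carrier M. \<zero>\<^bsub>N\<^esub>}" if "h \<in> Hom A M N" for h
    using Hom_eqI[OF that zero_in_Hom[OF assms(1,2)]] assms(3)[OF that] by simp
qed (use zero_in_Hom[OF assms(1,2)] in simp)

lemma Hom_vanishesD:
  "\<lbrakk>Hom_vanishes A M N; h \<in> Hom A M N; x \<in> carrier M\<rbrakk> \<Longrightarrow> h x = \<zero>\<^bsub>N\<^esub>"
  by (auto simp: Hom_vanishes_def)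

lemma inclusion_in_Hom:
  assumes "left_module A M" "left_submodule A N M"
  shows "(\<lambda>x\<in>N. x) \<in> Hom A (M\<lparr>carrier := N\<rparr>) M"
  using assms(2) by (intro HomI) (auto simp: left_submodule_def)

text \<open>The elements of the quotient \<open>M/N\<close> are chosen representatives of the cosets instead of the cosets
  themselves, which are sets of elements of \<open>'m\<close>.\<close>

lemma exists_quotient_module:
  fixes K :: "'k ring" and A :: "('k, 'a) module" and M :: "('a, 'm) module"
  assumes "fd_algebra K A" "M \<in> fd_modules K A" and N: "left_submodule A N M"
  obtains Q p where "Q \<in> fd_modules K A" "p \<in> Hom A M Q" "p ` carrier M = carrier Q" "ker M Q p = N"
proof -
  have M: "left_module A M" using assms(2) by (rule fd_modulesD)
  interpret left_module A M by fact
  have N0: "\<zero>\<^bsub>M\<^esub> \<in> N" and Nadd: "\<And>x y. \<lbrakk>x \<in> N; y \<in> N\<rbrakk> \<Longrightarrow> x \<oplus>\<^bsub>M\<^esub> y \<in> N"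
    and Nact: "\<And>a x. \<lbrakk>a \<in> carrier A; x \<in> N\<rbrakk> \<Longrightarrow> a \<odot>\<^bsub>M\<^esub> x \<in> N"
    and NM: "\<And>x. x \<in> N \<Longrightarrow> x \<in> carrier M"
    using N by (auto simp: left_submodule_def)
  have Nneg: "\<ominus>\<^bsub>M\<^esub> x \<in> N" if "x \<in> N" for x
    using act_minus_one[OF NM[OF that]] Nact[OF _ that, of "\<ominus>\<^bsub>A\<^esub> \<one>\<^bsub>A\<^esub>"] by simp
  \<comment> \<open>\<open>E x y\<close> says that \<open>x\<close> and \<open>y\<close> are in the same coset of \<open>N\<close>.\<close>
  define E where "E x y \<longleftrightarrow> y \<in> carrier M \<and> (\<exists>n\<in>N. y = x \<oplus>\<^bsub>M\<^esub> n)" for x y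
  have E_refl: "E x x" if "x \<in> carrier M" for x
    using that N0 by (auto simp: E_def intro: bexI[of _ "\<zero>\<^bsub>M\<^esub>"])
  have E_sym: "E y x" if "E x y" "x \<in> carrier M" for x y
    using that Nneg NM by (auto simp: E_def M.a_assoc M.r_neg intro!: bexI[of _ "\<ominus>\<^bsub>M\<^esub> n" for n])
  have E_trans: "E x z" if "E x y" "E y z" "x \<in> carrier M" for x y z
    using that Nadd NM by (auto simp: E_def M.a_assoc)
  define r where "r x = (SOME y. E x y)" for x
  have r: "E x (r x)" if "x \<in> carrier M" for x
    unfolding r_def using E_refl[OF that] by (rule someI)
  have r_eq: "r x = r y \<longleftrightarrow> E x y" if "x \<in> carrier M" "y \<in> carrier M" for x y
  proof
    assume "r x = r y"
    then show "E x y" using r[OF that(1)] r[OF that(2)] E_sym E_trans that by metis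
  next
    assume "E x y"
    then have "E x = E y" using E_sym E_trans that by blast
    then show "r x = r y" by (simp add: r_def)
  qed
  have comp: "respects_operations A M r"
    unfolding respects_operations_def
  proof (intro conjI ballI impI)
    fix x x' y y' assume *: "x \<in> carrier M" "x' \<in> carrier M" "y \<in> carrier M" "y' \<in> carrier M"
      "r x = r x'" "r y = r y'"
    then obtain n n' where n: "n \<in> N" "x' = x \<oplus>\<^bsub>M\<^esub> n" "n' \<in> N" "y' = y \<oplus>\<^bsub>M\<^esub> n'"
      by (auto simp: r_eq E_def)
    have "x' \<oplus>\<^bsub>M\<^esub> y' = (x \<oplus>\<^bsub>M\<^esub> y) \<oplus>\<^bsub>M\<^esub> (n \<oplus>\<^bsub>M\<^esub> n')" using n * NM by (simp add: M.a_ac)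
    then have "E (x \<oplus>\<^bsub>M\<^esub> y) (x' \<oplus>\<^bsub>M\<^esub> y')" using n * Nadd NM unfolding E_def by blast
    then show "r (x \<oplus>\<^bsub>M\<^esub> y) = r (x' \<oplus>\<^bsub>M\<^esub> y')" using * by (simp add: r_eq)
  next
    fix a x x' assume *: "a \<in> carrier A" "x \<in> carrier M" "x' \<in> carrier M" "r x = r x'"
    then obtain n where n: "n \<in> N" "x' = x \<oplus>\<^bsub>M\<^esub> n" by (auto simp: r_eq E_def)
    have "a \<odot>\<^bsub>M\<^esub> x' = a \<odot>\<^bsub>M\<^esub> x \<oplus>\<^bsub>M\<^esub> a \<odot>\<^bsub>M\<^esub> n" using n * NM by (simp add: act_r_distr)
    then have "E (a \<odot>\<^bsub>M\<^esub> x) (a \<odot>\<^bsub>M\<^esub> x')" using n(1) * Nact act_closed unfolding E_def by blast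
    then show "r (a \<odot>\<^bsub>M\<^esub> x) = r (a \<odot>\<^bsub>M\<^esub> x')" using * by (simp add: r_eq act_closed)
  qed
  let ?Q = "image_module M r"
  have Q: "left_module A ?Q" by (rule left_module_image_module[OF M comp])
  have car: "r ` carrier M = carrier ?Q" by (simp add: image_module_def)
  have "?Q \<in> fd_modules K A"
    by (rule fd_modules_image[OF assms(1,2) Q image_module_hom[OF comp] car])
  moreover have "restrict r (carrier M) \<in> Hom A M ?Q"
    by (rule module_hom_restrict_in_Hom[OF M image_module_hom[OF comp]])
  moreover have "ker M ?Q (restrict r (carrier M)) = N"
  proof -
    have "r x = r \<zero>\<^bsub>M\<^esub> \<longleftrightarrow> x \<in> N" if "x \<in> carrier M" for x
    proof -
      have "r x = r \<zero>\<^bsub>M\<^esub> \<longleftrightarrow> E \<zero>\<^bsub>M\<^esub> x" using that r_eq[of "\<zero>\<^bsub>M\<^esub>" x] by auto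
      then show ?thesis using that NM by (auto simp: E_def)
    qed
    then show ?thesis using NM by (auto simp: ker_def image_module_def)
  qed
  ultimately show thesis using that car by simp
qed

lemma torsion_iff:
  assumes "torsion_pair K A \<T> \<F>"
  shows "X \<in> \<T> \<longleftrightarrow> X \<in> fd_modules K A \<and> (\<forall>F\<in>\<F>. Hom_vanishes A X F)"
  using arg_cong[OF conjunct1[OF assms[unfolded torsion_pair_def]], of "\<lambda>S. X \<in> S"] by simp

lemma torsion_free_iff:
  assumes "torsion_pair K A \<T> \<F>"
  shows "X \<in> \<F> \<longleftrightarrow> X \<in> fd_modules K A \<and> (\<forall>T\<in>\<T>. Hom_vanishes A T X)"
  using arg_cong[OF conjunct2[OF assms[unfolded torsion_pair_def]], of "\<lambda>S. X \<in> S"] by simp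

lemma Hom_torsion_torsion_free_eq_zero:
  assumes "torsion_pair K A \<T> \<F>" "T \<in> \<T>" "F \<in> \<F>" "h \<in> Hom A T F" "t \<in> carrier T"
  shows "h t = \<zero>\<^bsub>F\<^esub>"
proof (rule Hom_vanishesD[OF _ assms(4,5)])
  show "Hom_vanishes A T F" using assms(2,3) torsion_iff[OF assms(1)] by simp
qed

lemma
  assumes "torsion_pair K A \<T> \<F>"
  shows torsion_fd: "X \<in> \<T> \<Longrightarrow> X \<in> fd_modules K A"
    and torsion_free_fd: "X \<in> \<F> \<Longrightarrow> X \<in> fd_modules K A"
    and torsion_left_module: "X \<in> \<T> \<Longrightarrow> left_module A X"
    and torsion_free_left_module: "X \<in> \<F> \<Longrightarrow> left_module A X"
  by (blast dest: torsion_iff[OF assms, THEN iffD1] torsion_free_iff[OF assms, THEN iffD1]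
      fd_modulesD[of _ K A])+

lemma torsionI:
  assumes tp: "torsion_pair K A \<T> \<F>" and X: "X \<in> fd_modules K A"
    and "\<And>F h x. \<lbrakk>F \<in> \<F>; h \<in> Hom A X F; x \<in> carrier X\<rbrakk> \<Longrightarrow> h x = \<zero>\<^bsub>F\<^esub>"
  shows "X \<in> \<T>"
  unfolding torsion_iff[OF tp]
  using X assms(3) by (auto intro: Hom_vanishesI fd_modulesD torsion_free_left_module[OF tp])

lemma torsion_freeI:
  assumes tp: "torsion_pair K A \<T> \<F>" and X: "X \<in> fd_modules K A"
    and "\<And>T h t. \<lbrakk>T \<in> \<T>; h \<in> Hom A T X; t \<in> carrier T\<rbrakk> \<Longrightarrow> h t = \<zero>\<^bsub>X\<^esub>"
  shows "X \<in> \<F>"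
  unfolding torsion_free_iff[OF tp]
  using X assms(3) by (auto intro: Hom_vanishesI fd_modulesD torsion_left_module[OF tp])

text \<open>A map from a torsion module to \<open>X\<close> dies in \<open>F\<close>, hence already in \<open>X\<close>.\<close>

lemma torsion_free_if_embeds:
  assumes tp: "torsion_pair K A \<T> \<F>" and X: "X \<in> fd_modules K A"
    and F: "F \<in> \<F>" and v: "v \<in> Hom A X F" "ker X F v \<subseteq> {\<zero>\<^bsub>X\<^esub>}"
  shows "X \<in> \<F>"
proof (rule torsion_freeI[OF tp X])
  fix T h t assume T: "T \<in> \<T>" and h: "h \<in> Hom A T X" and t: "t \<in> carrier T"
  have "v (h t) = \<zero>\<^bsub>F\<^esub>"
    using Hom_torsion_torsion_free_eq_zero[OF tp T F
        compose_in_Hom[OF torsion_left_module[OF tp T] h v(1)] t] t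
    by (simp add: compose_def)
  then show "h t = \<zero>\<^bsub>X\<^esub>" using v(2) Hom_closed[OF h t] by (auto simp: ker_def)
qed

text \<open>A map from a torsion module to \<open>X\<close> dies in \<open>G\<close>, so it lands in \<open>F\<close>, where it is zero.\<close>

lemma torsion_free_closed_under_extensions:
  assumes tp: "torsion_pair K A \<T> \<F>" and FF: "F \<in> \<F>" "G \<in> \<F>" and X: "X \<in> fd_modules K A"
    and ses: "short_exact_seq A F j X p G"
  shows "X \<in> \<F>"
proof (rule torsion_freeI[OF tp X])
  have j: "j \<in> Hom A F X" "inj_on j (carrier F)" and p: "p \<in> Hom A X G"
    and ex: "j ` carrier F = ker X G p"
    using ses by (auto simp: short_exact_seq_def right_exact_seq_def)
  fix T h t assume T: "T \<in> \<T>" and h: "h \<in> Hom A T X" and t: "t \<in> carrier T"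
  have lT: "left_module A T" and lF: "left_module A F"
    using torsion_left_module[OF tp T] torsion_free_left_module[OF tp FF(1)] .
  have "p (h y) = \<zero>\<^bsub>G\<^esub>" if "y \<in> carrier T" for y
    using Hom_torsion_torsion_free_eq_zero[OF tp T FF(2) compose_in_Hom[OF lT h p] that] that
    by (simp add: compose_def)
  then have "h ` carrier T \<subseteq> j ` carrier F" using Hom_closed[OF h] by (auto simp: ex ker_def)
  then obtain k where k: "k \<in> Hom A T F" "\<And>y. y \<in> carrier T \<Longrightarrow> j (k y) = h y"
    using Hom_factors_through_injection[OF lT lF j h] by blast
  have "k t = \<zero>\<^bsub>F\<^esub>" by (rule Hom_torsion_torsion_free_eq_zero[OF tp T FF(1) k(1) t])
  then show "h t = \<zero>\<^bsub>X\<^esub>"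
    using k(2)[OF t] Hom_zero_apply[OF lF fd_modulesD[OF X] j(1)] by simp
qed

text \<open>The torsion submodule \<open>N\<close> of \<open>M\<close> is the common kernel of all maps from \<open>M\<close> to torsion-free modules.
  Every such map factors through \<open>M/N\<close>, so a map from a torsion module to \<open>M/N\<close> becomes zero after
  composition with it, and is zero by the choice of \<open>N\<close>; hence \<open>M/N\<close> is torsion-free.  That \<open>N\<close> is torsion needs an argument, because
  a map \<open>u\<close> from \<open>N\<close> to a torsion-free module need not extend to \<open>M\<close>.  The remedy is to push out
  along \<open>u\<close>, that is, to look at \<open>M/ker u\<close> instead of \<open>M\<close>.\<close>

lemma canonical_torsion_sequence:
  fixes K :: "'k ring" and A :: "('k, 'a) module" and M :: "('a, 'm) module"
  assumes "fd_algebra K A" and tp: "torsion_pair K A \<T> \<F>" and "M \<in> fd_modules K A"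
  obtains T i Q p where "T \<in> \<T>" "Q \<in> \<F>" "short_exact_seq A T i M p Q"
proof -
  have M: "left_module A M" using assms(3) by (rule fd_modulesD)
  interpret left_module A M by fact
  define N where "N = {x \<in> carrier M. \<forall>F\<in>\<F>. \<forall>g\<in>Hom A M F. g x = \<zero>\<^bsub>F\<^esub>}"
  have NM: "N \<subseteq> carrier M" and Nzero: "\<And>F g x. \<lbrakk>x \<in> N; F \<in> \<F>; g \<in> Hom A M F\<rbrakk> \<Longrightarrow> g x = \<zero>\<^bsub>F\<^esub>"
    by (auto simp: N_def)
  have Nsub: "left_submodule A N M"
  proof -
    have N_Int: "N = {x \<in> carrier M. \<forall>F\<in>\<F>. \<forall>g\<in>Hom A M F. x \<in> ker M F g}"
      by (auto simp: N_def ker_def)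
    have "left_submodule A (ker M F g) M" if "F \<in> \<F>" "g \<in> Hom A M F" for F g
      using left_submodule_ker[OF M torsion_free_left_module[OF tp that(1)] that(2)] .
    then show ?thesis unfolding left_submodule_def N_Int
      using act_closed by (simp add: subset_iff)
  qed
  obtain Q p where Q: "Q \<in> fd_modules K A" and p: "p \<in> Hom A M Q" "p ` carrier M = carrier Q"
    and ker_p: "ker M Q p = N"
    using exists_quotient_module[OF assms(1,3) Nsub] .
  have Ql: "left_module A Q" using Q by (rule fd_modulesD)
  have "Q \<in> \<F>"
  proof (rule torsion_freeI[OF tp Q])
    fix T h t assume T: "T \<in> \<T>" and h: "h \<in> Hom A T Q" and t: "t \<in> carrier T"
    obtain x where x: "x \<in> carrier M" "h t = p x"
      using Hom_closed[OF h t] p(2) by (metis imageE)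
    have "g x = \<zero>\<^bsub>F\<^esub>" if F: "F \<in> \<F>" and g: "g \<in> Hom A M F" for F g
    proof -
      have "ker M Q p \<subseteq> ker M F g"
        unfolding ker_p using Nzero[OF _ F g] NM by (auto simp: ker_def)
      then obtain k where k: "k \<in> Hom A Q F" "\<And>x. x \<in> carrier M \<Longrightarrow> k (p x) = g x"
        using Hom_factors_through_surjection[OF M Ql torsion_free_left_module[OF tp F] p g] by blast
      have "k (h t) = \<zero>\<^bsub>F\<^esub>"
        using Hom_torsion_torsion_free_eq_zero[OF tp T F
            compose_in_Hom[OF torsion_left_module[OF tp T] h k(1)] t] t
        by (simp add: compose_def)
      then show ?thesis using x k(2) by simp
    qed
    then have "x \<in> ker M Q p" unfolding ker_p N_def using x by simp
    then show "h t = \<zero>\<^bsub>Q\<^esub>" using x by (simp add: ker_def)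
  qed
  let ?T = "M\<lparr>carrier := N\<rparr>"
  have T: "?T \<in> fd_modules K A" by (rule fd_modules_submodule[OF assms(1,3) Nsub])
  have Tl: "left_module A ?T" using T by (rule fd_modulesD)
  have i: "(\<lambda>x\<in>N. x) \<in> Hom A ?T M" by (rule inclusion_in_Hom[OF M Nsub])
  have "?T \<in> \<T>"
  proof (rule torsionI[OF tp T])
    fix F u x assume F: "F \<in> \<F>" and u: "u \<in> Hom A ?T F" and "x \<in> carrier ?T"
    then have x: "x \<in> N" by simp
    have Fl: "left_module A F" by (rule torsion_free_left_module[OF tp F])
    let ?L = "ker ?T F u"
    have LN: "?L \<subseteq> N" by (auto simp: ker_def)
    have "left_submodule A ?L ?T" by (rule left_submodule_ker[OF Tl Fl u])
    then have L: "left_submodule A ?L M"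
      using NM by (auto simp: left_submodule_def)
    \<comment> \<open>Modulo the kernel of \<open>u\<close> the module \<open>M\<close> is an extension of \<open>Q\<close> by the image of \<open>u\<close>, so it
      is torsion-free and the projection to it kills \<open>N\<close>.\<close>
    obtain P q where P: "P \<in> fd_modules K A" and q: "q \<in> Hom A M P" "q ` carrier M = carrier P"
      and ker_q: "ker M P q = ?L"
      using exists_quotient_module[OF assms(1,3) L] .
    have Pl: "left_module A P" using P by (rule fd_modulesD)
    have "ker M P q \<subseteq> ker M Q p" using LN by (simp add: ker_q ker_p)
    then obtain s where s: "s \<in> Hom A P Q" "\<And>x. x \<in> carrier M \<Longrightarrow> s (q x) = p x"
      using Hom_factors_through_surjection[OF M Pl Ql q p(1)] by blast
    have s_surj: "s ` carrier P = carrier Q"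
      using s(2) p(2) q(2) by (metis image_cong image_image)
    let ?N' = "ker P Q s"
    have N': "left_submodule A ?N' P" by (rule left_submodule_ker[OF Pl Ql s(1)])
    let ?P' = "P\<lparr>carrier := ?N'\<rparr>"
    have P': "?P' \<in> fd_modules K A" by (rule fd_modules_submodule[OF assms(1) P N'])
    have qN: "q ` N = ?N'"
    proof (intro equalityI subsetI)
      fix y assume "y \<in> q ` N"
      then obtain n where n: "n \<in> ker M Q p" "y = q n" unfolding ker_p by blast
      then show "y \<in> ?N'" using s(2) Hom_closed[OF q(1)] by (simp add: ker_def)
    next
      fix y assume y: "y \<in> ?N'"
      then have "y \<in> q ` carrier M" using q(2) by (simp add: ker_def)
      then obtain m where m: "m \<in> carrier M" "y = q m" by blast
      then have "m \<in> ker M Q p" using y s(2)[OF m(1)] by (simp add: ker_def)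
      then show "y \<in> q ` N" unfolding ker_p using m by blast
    qed
    have q': "restrict q N \<in> Hom A ?T ?P'"
    proof (rule HomI)
      show "restrict q N x \<in> carrier ?P'" if "x \<in> carrier ?T" for x using that qN by auto
    qed (use Nsub Hom_add[OF q(1)] Hom_act[OF q(1)] NM in \<open>simp_all add: left_submodule_def subset_iff\<close>)
    have "ker ?T ?P' (restrict q N) \<subseteq> ker ?T F u"
    proof
      fix x assume "x \<in> ker ?T ?P' (restrict q N)"
      then have "x \<in> ker M P q" using NM by (auto simp: ker_def)
      then show "x \<in> ker ?T F u" unfolding ker_q .
    qed
    moreover have "restrict q N ` carrier ?T = carrier ?P'" using qN by simp
    ultimately obtain v where v': "v \<in> Hom A ?P' F"
        "\<And>x. x \<in> carrier ?T \<Longrightarrow> v (restrict q N x) = u x"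
      using Hom_factors_through_surjection[OF Tl fd_modulesD[OF P'] Fl q' _ u] by blast
    have v: "v (q x) = u x" if "x \<in> N" for x
      using v'(2)[of x] that by simp
    \<comment> \<open>\<open>?P'\<close> is the image of \<open>N\<close> in \<open>P\<close>, and \<open>v\<close> embeds it into \<open>F\<close>.\<close>
    have "ker ?P' F v \<subseteq> {\<zero>\<^bsub>?P'\<^esub>}"
    proof
      fix y assume y: "y \<in> ker ?P' F v"
      then have "y \<in> q ` N" unfolding qN by (simp add: ker_def)
      then obtain n where n: "n \<in> N" "y = q n" by blast
      then have "n \<in> ker M P q" unfolding ker_q using y v[OF n(1)] by (simp add: ker_def)
      then show "y \<in> {\<zero>\<^bsub>?P'\<^esub>}" using n by (simp add: ker_def)
    qed
    then have "?P' \<in> \<F>" by (rule torsion_free_if_embeds[OF tp P' F v'(1)])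
    moreover have "short_exact_seq A ?P' (\<lambda>x\<in>?N'. x) P s Q"
      using inclusion_in_Hom[OF Pl N'] s s_surj
      by (simp add: short_exact_seq_def right_exact_seq_def inj_on_def)
    ultimately have "P \<in> \<F>"
      using torsion_free_closed_under_extensions[OF tp _ \<open>Q \<in> \<F>\<close> P] by blast
    then have "q x = \<zero>\<^bsub>P\<^esub>" using Nzero x q(1) by blast
    then have "x \<in> ker M P q" using x NM by (auto simp: ker_def)
    then show "u x = \<zero>\<^bsub>F\<^esub>" unfolding ker_q by (simp add: ker_def)
  qed
  moreover have "short_exact_seq A ?T (\<lambda>x\<in>N. x) M p Q"
    using i p ker_p by (simp add: short_exact_seq_def right_exact_seq_def inj_on_def)
  ultimately show thesis using that \<open>Q \<in> \<F>\<close> by blast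
qed

text \<open>A map from \<open>X\<close> to a torsion-free module kills \<open>S\<close>, so it factors through \<open>T\<close>, on which it is zero.\<close>

lemma torsion_closed_under_extensions:
  assumes tp: "torsion_pair K A \<T> \<F>" and TT: "S \<in> \<T>" "T \<in> \<T>" and X: "X \<in> fd_modules K A"
    and ses: "short_exact_seq A S j X f T"
  shows "X \<in> \<T>"
proof (rule torsionI[OF tp X])
  have j: "j \<in> Hom A S X" and f: "f \<in> Hom A X T" "f ` carrier X = carrier T"
    and ex: "ker X T f = j ` carrier S"
    using ses by (auto simp: short_exact_seq_def right_exact_seq_def)
  note l = torsion_left_module[OF tp TT(1)] torsion_left_module[OF tp TT(2)] fd_modulesD[OF X]
  fix F h x assume F: "F \<in> \<F>" and h: "h \<in> Hom A X F" and x: "x \<in> carrier X"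
  have "h (j s) = \<zero>\<^bsub>F\<^esub>" if "s \<in> carrier S" for s
    using Hom_torsion_torsion_free_eq_zero[OF tp TT(1) F compose_in_Hom[OF l(1) j h] that] that
    by (simp add: compose_def)
  then have "ker X T f \<subseteq> ker X F h"
    unfolding ex using Hom_closed[OF j] by (auto simp: ker_def)
  then obtain k where k: "k \<in> Hom A T F" "\<And>x. x \<in> carrier X \<Longrightarrow> k (f x) = h x"
    using Hom_factors_through_surjection[OF l(3,2) torsion_free_left_module[OF tp F] f h] by blast
  show "h x = \<zero>\<^bsub>F\<^esub>"
    using Hom_torsion_torsion_free_eq_zero[OF tp TT(2) F k(1) Hom_closed[OF f(1) x]] k(2)[OF x]
    by simp
qed

section \<open>Lifting along surjections with vanishing \<open>Ext\<close>\<close>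

text \<open>The class of an extension contains that extension, and by hypothesis it is the class of the split
  extensions.\<close>

lemma split_if_Ext1_trivial:
  assumes "Ext1 K A C T = {Ext1_zero K A C T}" and E: "(E, i, p) \<in> extensions K A C T"
  obtains s where "s \<in> Hom A C E" and "\<And>c. c \<in> carrier C \<Longrightarrow> p (s c) = c"
proof -
  have lE: "left_module A E" and i: "i \<in> Hom A T E"
    using E by (auto simp: extensions_def fd_modules_def short_exact_seq_def right_exact_seq_def)
  have "((E, i, p), (E, i, p)) \<in> extension_equiv K A C T"
    using E id_in_Hom[OF lE] Hom_closed[OF i]
    by (auto simp: extension_equiv_def bij_betw_def inj_on_def
        intro!: bexI[where x="\<lambda>x\<in>carrier E. x"])
  moreover have "extension_equiv K A C T `` {(E, i, p)} \<in> Ext1 K A C T"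
    unfolding Ext1_def using E by (rule quotientI)
  ultimately have "(E, i, p) \<in> Ext1_zero K A C T" unfolding assms(1) by blast
  then show thesis using that by (auto simp: Ext1_zero_def)
qed

text \<open>The pullback of \<open>p\<close> along \<open>g\<close> is an extension of \<open>X\<close> by \<open>T\<close>.  A section of it, followed by the
  projection to \<open>Y\<close>, is the required lift.  The elements of the pullback are pairs; an infinite type
  \<open>'m\<close> contains a copy of \<open>'m \<times> 'm\<close>, to which the pullback is transported.\<close>

lemma lift_along_surjection_if_Ext1_trivial:
  fixes K :: "'k ring" and A :: "('k, 'a) module" and X :: "('a, 'm) module"
  assumes K: "fd_algebra K A" and inf: "infinite (UNIV :: 'm set)"
    and fd: "X \<in> fd_modules K A" "T \<in> fd_modules K A"
    and Y: "left_module A Y" and Q: "left_module A Q"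
    and ses: "short_exact_seq A T i Y p Q"
    and ext: "Ext1 K A X T = {Ext1_zero K A X T}"
    and g: "g \<in> Hom A X Q"
  obtains f where "f \<in> Hom A X Y" and "\<And>x. x \<in> carrier X \<Longrightarrow> p (f x) = g x"
proof -
  have X: "left_module A X" and T: "left_module A T" using fd by (auto dest: fd_modulesD)
  interpret X: left_module A X by fact
  interpret T: left_module A T by fact
  interpret Y: left_module A Y by fact
  interpret Q: left_module A Q by fact
  have i: "i \<in> Hom A T Y" "inj_on i (carrier T)" and p: "p \<in> Hom A Y Q" "p ` carrier Y = carrier Q"
    and ex: "i ` carrier T = ker Y Q p"
    using ses by (auto simp: short_exact_seq_def right_exact_seq_def)
  note g0 = Hom_zero_apply[OF X Q g] and p0 = Hom_zero_apply[OF Y Q p(1)]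
  obtain e :: "'m \<times> 'm \<Rightarrow> 'm" where "bij_betw e (UNIV \<times> UNIV) UNIV"
    using card_of_ordIso[THEN iffD2, OF card_of_Times_same_infinite[OF inf]] by blast
  then have e: "e u = e v \<longleftrightarrow> u = v" for u v
    by (auto simp: bij_betw_def dest: injD)
  \<comment> \<open>\<open>N\<close> is the pullback, \<open>?E\<close> its copy in \<open>'m\<close>, and \<open>p1\<close> and \<open>p2\<close> are the projections.\<close>
  define N where "N = {(x, y). x \<in> carrier X \<and> y \<in> carrier Y \<and> g x = p y}"
  let ?P = "(direct_sum X Y)\<lparr>carrier := N\<rparr>"
  have "left_submodule A N (direct_sum X Y)"
    using Hom_add[OF g] Hom_add[OF p(1)] Hom_act[OF g] Hom_act[OF p(1)] g0 p0
    by (auto simp: left_submodule_def N_def direct_sum_def X.act_closed Y.act_closed)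
  then have P: "left_module A ?P"
    using left_module_submodule[OF left_module_direct_sum[OF X Y]] by blast
  let ?E = "image_module ?P e"
  have comp: "respects_operations A ?P e" by (simp add: respects_operations_def e)
  have E: "left_module A ?E" by (rule left_module_image_module[OF P comp])
  interpret E: left_module A ?E by fact
  note hom = image_module_hom[OF comp]
  have car: "carrier ?E = e ` N" by (simp add: image_module_def)
  have add: "e (x, y) \<oplus>\<^bsub>?E\<^esub> e (x', y') = e (x \<oplus>\<^bsub>X\<^esub> x', y \<oplus>\<^bsub>Y\<^esub> y')"
    if "(x, y) \<in> N" "(x', y') \<in> N" for x y x' y'
    using module_hom_add[OF hom, of "(x, y)" "(x', y')"] that by (simp add: direct_sum_def)
  have act: "a \<odot>\<^bsub>?E\<^esub> e (x, y) = e (a \<odot>\<^bsub>X\<^esub> x, a \<odot>\<^bsub>Y\<^esub> y)"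
    if "a \<in> carrier A" "(x, y) \<in> N" for a x y
    using module_hom_smult[OF hom, of a "(x, y)"] that by (simp add: direct_sum_def)
  define d where "d = inv_into UNIV e"
  have d: "d (e u) = u" for u by (simp add: d_def inv_f_f inj_def e)
  define p1 where "p1 = (\<lambda>z\<in>carrier ?E. fst (d z))"
  define p2 where "p2 = (\<lambda>z\<in>carrier ?E. snd (d z))"
  have p1_e: "p1 (e (x, y)) = x" and p2_e: "p2 (e (x, y)) = y" if "(x, y) \<in> N" for x y
    using that by (auto simp: p1_def p2_def d car)
  have elim: "\<exists>x y. z = e (x, y) \<and> (x, y) \<in> N \<and> x \<in> carrier X \<and> y \<in> carrier Y \<and> g x = p y"
    if "z \<in> carrier ?E" for z
  proof -
    obtain x y where "z = e (x, y)" "(x, y) \<in> N" using \<open>z \<in> carrier ?E\<close> unfolding car by auto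
    then show ?thesis by (auto simp: N_def)
  qed
  have cl: "(x \<oplus>\<^bsub>X\<^esub> x', y \<oplus>\<^bsub>Y\<^esub> y') \<in> N" if "(x, y) \<in> N" "(x', y') \<in> N" for x y x' y'
    using that by (auto simp: N_def Hom_add[OF g] Hom_add[OF p(1)])
  have cl': "(a \<odot>\<^bsub>X\<^esub> x, a \<odot>\<^bsub>Y\<^esub> y) \<in> N" if "a \<in> carrier A" "(x, y) \<in> N" for a x y
    using that by (auto simp: N_def Hom_act[OF g] Hom_act[OF p(1)] X.act_closed Y.act_closed)
  have p1: "p1 \<in> Hom A ?E X"
  proof (rule HomI)
    show "p1 \<in> extensional (carrier ?E)" by (simp add: p1_def)
    fix z assume "z \<in> carrier ?E"
    then obtain x y where z: "z = e (x, y)" "(x, y) \<in> N" "x \<in> carrier X" using elim by blast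
    then show "p1 z \<in> carrier X" by (simp add: p1_e)
    show "p1 (a \<odot>\<^bsub>?E\<^esub> z) = a \<odot>\<^bsub>X\<^esub> p1 z" if "a \<in> carrier A" for a
      using that z by (simp add: act p1_e cl')
    fix z' assume "z' \<in> carrier ?E"
    then obtain x' y' where "z' = e (x', y')" "(x', y') \<in> N" using elim by blast
    then show "p1 (z \<oplus>\<^bsub>?E\<^esub> z') = p1 z \<oplus>\<^bsub>X\<^esub> p1 z'" using z by (simp add: add p1_e cl)
  qed
  have p2: "p2 \<in> Hom A ?E Y"
  proof (rule HomI)
    show "p2 \<in> extensional (carrier ?E)" by (simp add: p2_def)
    fix z assume "z \<in> carrier ?E"
    then obtain x y where z: "z = e (x, y)" "(x, y) \<in> N" "y \<in> carrier Y" using elim by blast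
    then show "p2 z \<in> carrier Y" by (simp add: p2_e)
    show "p2 (a \<odot>\<^bsub>?E\<^esub> z) = a \<odot>\<^bsub>Y\<^esub> p2 z" if "a \<in> carrier A" for a
      using that z by (simp add: act p2_e cl')
    fix z' assume "z' \<in> carrier ?E"
    then obtain x' y' where "z' = e (x', y')" "(x', y') \<in> N" using elim by blast
    then show "p2 (z \<oplus>\<^bsub>?E\<^esub> z') = p2 z \<oplus>\<^bsub>Y\<^esub> p2 z'" using z by (simp add: add p2_e cl)
  qed
  have p1_surj: "p1 ` carrier ?E = carrier X"
  proof (intro equalityI subsetI)
    fix x assume x: "x \<in> carrier X"
    then have "g x \<in> p ` carrier Y" using p(2) Hom_closed[OF g] by simp
    then obtain y where "y \<in> carrier Y" "g x = p y" by blast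
    then have "(x, y) \<in> N" using x by (simp add: N_def)
    then show "x \<in> p1 ` carrier ?E" using p1_e by (metis car image_eqI)
  qed (use Hom_closed[OF p1] in auto)
  define j where "j = (\<lambda>t\<in>carrier T. e (\<zero>\<^bsub>X\<^esub>, i t))"
  have iN: "(\<zero>\<^bsub>X\<^esub>, i t) \<in> N" if "t \<in> carrier T" for t
  proof -
    have "i t \<in> ker Y Q p" using ex that by blast
    then show ?thesis by (simp add: N_def ker_def g0)
  qed
  have j: "j \<in> Hom A T ?E"
  proof (rule HomI)
    show "j (a \<odot>\<^bsub>T\<^esub> t) = a \<odot>\<^bsub>?E\<^esub> j t" if "a \<in> carrier A" "t \<in> carrier T" for a t
      using that by (simp add: j_def act iN T.act_closed Hom_act[OF i(1)] X.act_zero)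
    show "j (t \<oplus>\<^bsub>T\<^esub> t') = j t \<oplus>\<^bsub>?E\<^esub> j t'" if "t \<in> carrier T" "t' \<in> carrier T" for t t'
      using that by (simp add: j_def add iN Hom_add[OF i(1)])
  qed (auto simp: j_def car iN)
  have exact: "j ` carrier T = ker ?E X p1"
  proof (intro equalityI subsetI)
    fix z assume "z \<in> j ` carrier T"
    then obtain t where "t \<in> carrier T" "z = e (\<zero>\<^bsub>X\<^esub>, i t)" by (auto simp: j_def)
    then show "z \<in> ker ?E X p1" by (simp add: ker_def car p1_e iN)
  next
    fix z assume "z \<in> ker ?E X p1"
    then have "z \<in> carrier ?E" "p1 z = \<zero>\<^bsub>X\<^esub>" by (auto simp: ker_def)
    then obtain y where y: "z = e (\<zero>\<^bsub>X\<^esub>, y)" "y \<in> carrier Y" "g \<zero>\<^bsub>X\<^esub> = p y"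
      using elim p1_e by metis
    then have "y \<in> i ` carrier T" by (simp add: ex ker_def g0)
    then show "z \<in> j ` carrier T" using y(1) by (auto simp: j_def)
  qed
  have "?E \<in> fd_modules K A"
  proof (rule fd_modules_extension[OF K fd(2,1) E _ _ _ p1_surj])
    show "j \<in> module_hom A T ?E" "p1 \<in> module_hom A ?E X" using j p1 by (auto simp: Hom_def)
    show "z \<in> j ` carrier T" if "z \<in> carrier ?E" "p1 z = \<zero>\<^bsub>X\<^esub>" for z
      using that exact by (simp add: ker_def)
  qed
  moreover have "inj_on j (carrier T)"
    using i(2) by (auto simp: inj_on_def j_def e)
  ultimately have "(?E, j, p1) \<in> extensions K A X T"
    using j p1 exact p1_surj by (simp add: extensions_def short_exact_seq_def right_exact_seq_def)
  then obtain s where s: "s \<in> Hom A X ?E" "\<And>x. x \<in> carrier X \<Longrightarrow> p1 (s x) = x"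
    using split_if_Ext1_trivial[OF ext] by blast
  have "p (p2 (s x)) = g x" if "x \<in> carrier X" for x
  proof -
    obtain x' y where "s x = e (x', y)" "(x', y) \<in> N" "g x' = p y"
      using elim[OF Hom_closed[OF s(1) \<open>x \<in> carrier X\<close>]] by blast
    then show ?thesis using s(2)[OF that] by (simp add: p1_e p2_e)
  qed
  then show thesis
    using that[OF compose_in_Hom[OF X s(1) p2]] by (simp add: compose_def)
qed

section \<open>Quotients of categories by the kernel of a functor\<close>

text \<open>An inverse functor \<open>G\<close> chooses a preimage \<open>G N\<close> of every object \<open>N\<close>, up to an isomorphism
  \<open>e N : F (G N) \<rightarrow> N\<close>, and lifts the conjugates of morphisms.  All identities between morphisms of
  \<open>C\<close> are checked after applying the faithful functor \<open>F\<close>.\<close>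

lemma equivalent_if_fully_faithful_and_dense:
  assumes "category C" "category D" "is_functor C D F"
    and ff: "\<And>X Y. \<lbrakk>X \<in> Obj C; Y \<in> Obj C\<rbrakk>
        \<Longrightarrow> bij_betw (on_mor F X Y) (Mor C X Y) (Mor D (on_obj F X) (on_obj F Y))"
    and dense: "\<And>N. N \<in> Obj D \<Longrightarrow> \<exists>X\<in>Obj C. \<exists>h. is_iso D (on_obj F X) N h"
  shows "equivalent_categories C D"
proof -
  interpret C: category C by fact
  interpret D: category D by fact
  have FO: "on_obj F X \<in> Obj D" if "X \<in> Obj C" for X
    using assms(3) that by (simp add: is_functor_def)
  have FM: "on_mor F X Y f \<in> Mor D (on_obj F X) (on_obj F Y)"
    if "X \<in> Obj C" "Y \<in> Obj C" "f \<in> Mor C X Y" for X Y f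
    using assms(3) that by (simp add: is_functor_def)
  have FI: "on_mor F X X (Ident C X) = Ident D (on_obj F X)" if "X \<in> Obj C" for X
    using assms(3) that by (simp add: is_functor_def)
  have FC: "on_mor F X Z (Comp C X Y Z g f) =
      Comp D (on_obj F X) (on_obj F Y) (on_obj F Z) (on_mor F Y Z g) (on_mor F X Y f)"
    if "X \<in> Obj C" "Y \<in> Obj C" "Z \<in> Obj C" "f \<in> Mor C X Y" "g \<in> Mor C Y Z" for X Y Z f g
    using assms(3) that unfolding is_functor_def by blast
  have inj: "f = g" if "X \<in> Obj C" "Y \<in> Obj C" "f \<in> Mor C X Y" "g \<in> Mor C X Y"
    "on_mor F X Y f = on_mor F X Y g" for X Y f g
    using ff[OF that(1,2)] that by (auto simp: bij_betw_def dest: inj_onD)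
  \<comment> \<open>\<open>L X Y\<close> lifts morphisms between \<open>F X\<close> and \<open>F Y\<close>.\<close>
  define L where "L X Y = inv_into (Mor C X Y) (on_mor F X Y)" for X Y
  have L: "L X Y h \<in> Mor C X Y" "on_mor F X Y (L X Y h) = h"
    if "X \<in> Obj C" "Y \<in> Obj C" "h \<in> Mor D (on_obj F X) (on_obj F Y)" for X Y h
    using ff[OF that(1,2)] that unfolding L_def
    by (auto simp: bij_betw_def intro!: inv_into_into f_inv_into_f)
  obtain G where G: "\<And>N. N \<in> Obj D \<Longrightarrow> G N \<in> Obj C \<and> (\<exists>h. is_iso D (on_obj F (G N)) N h)"
    using dense by metis
  then obtain e where e: "\<And>N. N \<in> Obj D \<Longrightarrow> is_iso D (on_obj F (G N)) N (e N)"
    by metis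
  obtain d where d: "\<And>N. N \<in> Obj D \<Longrightarrow> d N \<in> Mor D N (on_obj F (G N))
      \<and> Comp D (on_obj F (G N)) N (on_obj F (G N)) (d N) (e N) = Ident D (on_obj F (G N))
      \<and> Comp D N (on_obj F (G N)) N (e N) (d N) = Ident D N"
    using e unfolding is_iso_def by metis
  have eM: "e N \<in> Mor D (on_obj F (G N)) N" if "N \<in> Obj D" for N
    using e[OF that] by (simp add: is_iso_def)
  note dM = d[THEN conjunct1] and de = d[THEN conjunct2, THEN conjunct1]
    and ed = d[THEN conjunct2, THEN conjunct2]
  note [simp] = FO FM G[THEN conjunct1] eM dM C.comp_closed D.comp_closed C.ident_closed
    D.ident_closed D.comp_ident_left D.comp_ident_right L
  \<comment> \<open>Conjugation by the chosen isomorphisms turns \<open>h\<close> into a morphism between objects in the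
    image of \<open>F\<close>, which \<open>L\<close> then lifts.\<close>
  define H where "H N P h = Comp D (on_obj F (G N)) P (on_obj F (G P)) (d P)
      (Comp D (on_obj F (G N)) N P h (e N))" for N P h
  have HM [simp]: "H N P h \<in> Mor D (on_obj F (G N)) (on_obj F (G P))"
    if "N \<in> Obj D" "P \<in> Obj D" "h \<in> Mor D N P" for N P h
    unfolding H_def using that by simp
  have eH: "Comp D (on_obj F (G N)) (on_obj F (G P)) P (e P) (H N P h)
      = Comp D (on_obj F (G N)) N P h (e N)"
    if "N \<in> Obj D" "P \<in> Obj D" "h \<in> Mor D N P" for N P h
  proof -
    let ?k = "Comp D (on_obj F (G N)) N P h (e N)"
    have "Comp D (on_obj F (G N)) (on_obj F (G P)) P (e P) (H N P h)
        = Comp D (on_obj F (G N)) P P (Comp D P (on_obj F (G P)) P (e P) (d P)) ?k"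
      unfolding H_def using that by (intro D.comp_assoc[symmetric]) simp_all
    also have "\<dots> = ?k" using that by (simp add: ed)
    finally show ?thesis .
  qed
  have monic: "x = y"
    if "N \<in> Obj D" "M \<in> Obj D" "x \<in> Mor D M (on_obj F (G N))" "y \<in> Mor D M (on_obj F (G N))"
      "Comp D M (on_obj F (G N)) N (e N) x = Comp D M (on_obj F (G N)) N (e N) y" for M N x y
  proof -
    have *: "Comp D M N (on_obj F (G N)) (d N) (Comp D M (on_obj F (G N)) N (e N) z) = z"
      if "z \<in> Mor D M (on_obj F (G N))" for z
    proof -
      have "Comp D M N (on_obj F (G N)) (d N) (Comp D M (on_obj F (G N)) N (e N) z)
        = Comp D M (on_obj F (G N)) (on_obj F (G N))
            (Comp D (on_obj F (G N)) N (on_obj F (G N)) (d N) (e N)) z"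
        using that \<open>N \<in> Obj D\<close> \<open>M \<in> Obj D\<close> by (intro D.comp_assoc[symmetric]) simp_all
      then show ?thesis using that \<open>N \<in> Obj D\<close> \<open>M \<in> Obj D\<close> by (simp add: de)
    qed
    show ?thesis
      using arg_cong[OF that(5), of "Comp D M N (on_obj F (G N)) (d N)"]
      unfolding *[OF that(3)] *[OF that(4)] .
  qed
  let ?G = "\<lparr>on_obj = G, on_mor = (\<lambda>N P h. L (G N) (G P) (H N P h))\<rparr>"
  have HI: "H N N (Ident D N) = Ident D (on_obj F (G N))" if "N \<in> Obj D" for N
    unfolding H_def using that by (simp add: de)
  have HC: "H N Q (Comp D N P Q k h)
      = Comp D (on_obj F (G N)) (on_obj F (G P)) (on_obj F (G Q)) (H P Q k) (H N P h)"
    if that: "N \<in> Obj D" "P \<in> Obj D" "Q \<in> Obj D" "h \<in> Mor D N P" "k \<in> Mor D P Q" for N P Q h k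
  proof (rule monic[OF that(3)])
    note [simp] = that
    show "on_obj F (G N) \<in> Obj D" by simp
    show "H N Q (Comp D N P Q k h) \<in> Mor D (on_obj F (G N)) (on_obj F (G Q))" by simp
    show "Comp D (on_obj F (G N)) (on_obj F (G P)) (on_obj F (G Q)) (H P Q k) (H N P h)
        \<in> Mor D (on_obj F (G N)) (on_obj F (G Q))" by simp
    have "Comp D (on_obj F (G N)) (on_obj F (G Q)) Q (e Q)
          (Comp D (on_obj F (G N)) (on_obj F (G P)) (on_obj F (G Q)) (H P Q k) (H N P h))
        = Comp D (on_obj F (G N)) (on_obj F (G P)) Q
            (Comp D (on_obj F (G P)) (on_obj F (G Q)) Q (e Q) (H P Q k)) (H N P h)"
      by (intro D.comp_assoc[symmetric]) simp_all
    also have "\<dots> = Comp D (on_obj F (G N)) (on_obj F (G P)) Q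
            (Comp D (on_obj F (G P)) P Q k (e P)) (H N P h)"
      by (simp add: eH)
    also have "\<dots> = Comp D (on_obj F (G N)) P Q k
            (Comp D (on_obj F (G N)) (on_obj F (G P)) P (e P) (H N P h))"
      by (intro D.comp_assoc) simp_all
    also have "\<dots> = Comp D (on_obj F (G N)) P Q k (Comp D (on_obj F (G N)) N P h (e N))"
      by (simp add: eH)
    also have "\<dots> = Comp D (on_obj F (G N)) N Q (Comp D N P Q k h) (e N)"
      by (intro D.comp_assoc[symmetric]) simp_all
    also have "\<dots> = Comp D (on_obj F (G N)) (on_obj F (G Q)) Q (e Q) (H N Q (Comp D N P Q k h))"
      by (simp add: eH)
    finally show "Comp D (on_obj F (G N)) (on_obj F (G Q)) Q (e Q) (H N Q (Comp D N P Q k h))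
        = Comp D (on_obj F (G N)) (on_obj F (G Q)) Q (e Q)
          (Comp D (on_obj F (G N)) (on_obj F (G P)) (on_obj F (G Q)) (H P Q k) (H N P h))" ..
  qed
  have functorG: "is_functor D C ?G"
    unfolding is_functor_def
  proof (intro conjI ballI)
    fix N assume "N \<in> Obj D"
    then have "L (G N) (G N) (H N N (Ident D N)) = Ident C (G N)"
      by (intro inj[of "G N" "G N"]) (simp_all add: HI FI)
    then show "on_mor ?G N N (Ident D N) = Ident C (on_obj ?G N)" by simp
  next
    fix N P Q h k assume "N \<in> Obj D" "P \<in> Obj D" "Q \<in> Obj D" "h \<in> Mor D N P" "k \<in> Mor D P Q"
    then have "L (G N) (G Q) (H N Q (Comp D N P Q k h))
        = Comp C (G N) (G P) (G Q) (L (G P) (G Q) (H P Q k)) (L (G N) (G P) (H N P h))"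
      by (intro inj[of "G N" "G Q"]) (simp_all add: FC HC)
    then show "on_mor ?G N Q (Comp D N P Q k h) = Comp C (on_obj ?G N) (on_obj ?G P) (on_obj ?G Q)
        (on_mor ?G P Q k) (on_mor ?G N P h)" by simp
  qed simp_all
  have FG_id: "naturally_isomorphic D D (comp_func F ?G) id_func"
    unfolding naturally_isomorphic_def
    by (rule exI[of _ e]) (simp add: comp_func_def id_func_def e eH)
  have GF_id: "naturally_isomorphic C C (comp_func ?G F) id_func"
    unfolding naturally_isomorphic_def
  proof (intro exI conjI ballI)
    let ?h = "\<lambda>X. L (G (on_obj F X)) X (e (on_obj F X))"
    fix X assume X [simp]: "X \<in> Obj C"
    let ?k = "L X (G (on_obj F X)) (d (on_obj F X))"
    have "Comp C (G (on_obj F X)) X (G (on_obj F X)) ?k (?h X) = Ident C (G (on_obj F X))"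
      by (intro inj[of "G (on_obj F X)" "G (on_obj F X)"]) (simp_all add: FC FI de)
    moreover have "Comp C X (G (on_obj F X)) X (?h X) ?k = Ident C X"
      by (intro inj[of X X]) (simp_all add: FC FI ed)
    moreover have "?h X \<in> Mor C (G (on_obj F X)) X" "?k \<in> Mor C X (G (on_obj F X))" by simp_all
    ultimately show "is_iso C (on_obj (comp_func ?G F) X) (on_obj id_func X) (?h X)"
      by (auto simp: is_iso_def comp_func_def id_func_def)
    fix Y f assume [simp]: "Y \<in> Obj C" "f \<in> Mor C X Y"
    let ?g = "L (G (on_obj F X)) (G (on_obj F Y)) (H (on_obj F X) (on_obj F Y) (on_mor F X Y f))"
    have "Comp C (G (on_obj F X)) (G (on_obj F Y)) Y (?h Y) ?g
        = Comp C (G (on_obj F X)) X Y f (?h X)"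
      by (intro inj[of "G (on_obj F X)" Y]) (simp_all add: FC eH)
    then show "Comp C (on_obj (comp_func ?G F) X) (on_obj (comp_func ?G F) Y) (on_obj id_func Y)
          (?h Y) (on_mor (comp_func ?G F) X Y f)
        = Comp C (on_obj (comp_func ?G F) X) (on_obj id_func X) (on_obj id_func Y)
          (on_mor id_func X Y f) (?h X)"
      by (simp add: comp_func_def id_func_def)
  qed
  show ?thesis
    unfolding equivalent_categories_def
    using assms(1-3) functorG FG_id GF_id by blast
qed

text \<open>The homomorphism theorem for categories: a full functor becomes faithful once morphisms with equal
  images are identified.  Composition of classes is well defined because \<open>F\<close> preserves composition.\<close>

lemma equivalent_if_quotient_by_kernel:
  assumes "category C" "category D" "is_functor C D F"
    and full: "\<And>X Y. \<lbrakk>X \<in> Obj C; Y \<in> Obj C\<rbrakk>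
        \<Longrightarrow> Mor D (on_obj F X) (on_obj F Y) \<subseteq> on_mor F X Y ` Mor C X Y"
    and dense: "\<And>N. N \<in> Obj D \<Longrightarrow> \<exists>X\<in>Obj C. \<exists>h. is_iso D (on_obj F X) N h"
    and R: "\<And>X Y. \<lbrakk>X \<in> Obj C; Y \<in> Obj C\<rbrakk> \<Longrightarrow>
        R X Y = {(f, g). f \<in> Mor C X Y \<and> g \<in> Mor C X Y \<and> on_mor F X Y f = on_mor F X Y g}"
  shows "equivalent_categories
      \<lparr>Obj = Obj C, Mor = (\<lambda>X Y. Mor C X Y // R X Y), Ident = (\<lambda>X. R X X `` {Ident C X}),
       Comp = (\<lambda>X Y Z \<beta> \<alpha>. \<Union>g\<in>\<beta>. \<Union>f\<in>\<alpha>. R X Z `` {Comp C X Y Z g f})\<rparr> D"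
    (is "equivalent_categories ?Q D")
proof -
  interpret C: category C by fact
  interpret D: category D by fact
  have FO: "on_obj F X \<in> Obj D" if "X \<in> Obj C" for X
    using assms(3) that by (simp add: is_functor_def)
  have FM: "on_mor F X Y f \<in> Mor D (on_obj F X) (on_obj F Y)"
    if "X \<in> Obj C" "Y \<in> Obj C" "f \<in> Mor C X Y" for X Y f
    using assms(3) that by (simp add: is_functor_def)
  have FI: "on_mor F X X (Ident C X) = Ident D (on_obj F X)" if "X \<in> Obj C" for X
    using assms(3) that by (simp add: is_functor_def)
  have FC: "on_mor F X Z (Comp C X Y Z g f) =
      Comp D (on_obj F X) (on_obj F Y) (on_obj F Z) (on_mor F Y Z g) (on_mor F X Y f)"
    if "X \<in> Obj C" "Y \<in> Obj C" "Z \<in> Obj C" "f \<in> Mor C X Y" "g \<in> Mor C Y Z" for X Y Z f g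
    using assms(3) that unfolding is_functor_def by blast
  define cls where "cls X Y f = R X Y `` {f}" for X Y f
  have cls: "cls X Y f = {g \<in> Mor C X Y. on_mor F X Y f = on_mor F X Y g}"
    if "X \<in> Obj C" "Y \<in> Obj C" "f \<in> Mor C X Y" for X Y f
    using that by (auto simp: cls_def R)
  have cls_eq: "cls X Y f = cls X Y g \<longleftrightarrow> on_mor F X Y f = on_mor F X Y g"
    if "X \<in> Obj C" "Y \<in> Obj C" "f \<in> Mor C X Y" "g \<in> Mor C X Y" for X Y f g
    using that by (auto simp: cls)
  have MorQ: "Mor ?Q X Y = cls X Y ` Mor C X Y" for X Y
    by (auto simp: quotient_def cls_def)
  have IdQ: "Ident ?Q X = cls X X (Ident C X)" for X
    by (simp add: cls_def)
  have CompQ: "Comp ?Q X Y Z (cls Y Z g) (cls X Y f) = cls X Z (Comp C X Y Z g f)"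
    if "X \<in> Obj C" "Y \<in> Obj C" "Z \<in> Obj C" "f \<in> Mor C X Y" "g \<in> Mor C Y Z" for X Y Z f g
  proof -
    have "cls X Z (Comp C X Y Z g' f') = cls X Z (Comp C X Y Z g f)"
      if "g' \<in> cls Y Z g" "f' \<in> cls X Y f" for g' f'
    proof -
      have "g' \<in> Mor C Y Z" "on_mor F Y Z g' = on_mor F Y Z g"
        "f' \<in> Mor C X Y" "on_mor F X Y f' = on_mor F X Y f"
        using that \<open>X \<in> _\<close> \<open>Y \<in> _\<close> \<open>Z \<in> _\<close> \<open>f \<in> _\<close> \<open>g \<in> _\<close> by (simp_all add: cls)
      then show ?thesis
        using \<open>X \<in> _\<close> \<open>Y \<in> _\<close> \<open>Z \<in> _\<close> \<open>f \<in> _\<close> \<open>g \<in> _\<close>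
        by (simp add: cls_eq FC C.comp_closed)
    qed
    moreover have "g \<in> cls Y Z g" "f \<in> cls X Y f" using that by (simp_all add: cls)
    ultimately have "(\<Union>g'\<in>cls Y Z g. \<Union>f'\<in>cls X Y f. cls X Z (Comp C X Y Z g' f'))
        = cls X Z (Comp C X Y Z g f)" by blast
    then show ?thesis by (simp add: cls_def)
  qed
  define \<Phi> where "\<Phi> = \<lparr>on_obj = on_obj F, on_mor = (\<lambda>X Y \<alpha>. on_mor F X Y (SOME f. f \<in> \<alpha>))\<rparr>"
  have \<Phi>O: "on_obj \<Phi> X = on_obj F X" for X by (simp add: \<Phi>_def)
  have \<Phi>M: "on_mor \<Phi> X Y (cls X Y f) = on_mor F X Y f"
    if "X \<in> Obj C" "Y \<in> Obj C" "f \<in> Mor C X Y" for X Y f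
  proof -
    have "f \<in> cls X Y f" using that by (simp add: cls)
    then have "(SOME g. g \<in> cls X Y f) \<in> cls X Y f" by (rule someI)
    then have "on_mor F X Y (SOME g. g \<in> cls X Y f) = on_mor F X Y f"
      using cls[OF that] by simp
    then show ?thesis by (simp add: \<Phi>_def)
  qed
  have ObjQ: "Obj ?Q = Obj C" by simp
  note Q = ObjQ MorQ IdQ
  show ?thesis
  proof (rule equivalent_if_fully_faithful_and_dense[OF _ assms(2)])
    show "category ?Q"
    proof (unfold_locales, unfold Q)
      show "cls X X (Ident C X) \<in> cls X X ` Mor C X X" if "X \<in> Obj C" for X
        using that C.ident_closed by blast
    next
      fix X Y Z f g
      assume *: "X \<in> Obj C" "Y \<in> Obj C" "Z \<in> Obj C" "f \<in> cls X Y ` Mor C X Y" "g \<in> cls Y Z ` Mor C Y Z"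
      then obtain f' g' where "f = cls X Y f'" "f' \<in> Mor C X Y" "g = cls Y Z g'" "g' \<in> Mor C Y Z"
        by blast
      then show "Comp ?Q X Y Z g f \<in> cls X Z ` Mor C X Z"
        using * by (simp only: CompQ) (simp add: C.comp_closed)
    next
      fix X Y f assume *: "X \<in> Obj C" "Y \<in> Obj C" "f \<in> cls X Y ` Mor C X Y"
      then obtain f' where f': "f = cls X Y f'" "f' \<in> Mor C X Y" by blast
      show "Comp ?Q X X Y f (cls X X (Ident C X)) = f"
        using * f' by (simp only: CompQ C.ident_closed C.comp_ident_right)
      show "Comp ?Q X Y Y (cls Y Y (Ident C Y)) f = f"
        using * f' by (simp only: CompQ C.ident_closed C.comp_ident_left)
    next
      fix W X Y Z f g h
      assume *: "W \<in> Obj C" "X \<in> Obj C" "Y \<in> Obj C" "Z \<in> Obj C"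
        "f \<in> cls W X ` Mor C W X" "g \<in> cls X Y ` Mor C X Y" "h \<in> cls Y Z ` Mor C Y Z"
      then obtain f' g' h' where "f = cls W X f'" "f' \<in> Mor C W X" "g = cls X Y g'" "g' \<in> Mor C X Y"
        "h = cls Y Z h'" "h' \<in> Mor C Y Z" by blast
      then show "Comp ?Q W X Z (Comp ?Q X Y Z h g) f = Comp ?Q W Y Z h (Comp ?Q W X Y g f)"
        using * by (simp only: CompQ C.comp_closed C.comp_assoc)
    qed
    show "is_functor ?Q D \<Phi>"
      unfolding is_functor_def Q \<Phi>O
    proof (intro conjI ballI)
      fix X Y Z \<alpha> \<beta> assume *: "X \<in> Obj C" "Y \<in> Obj C" "Z \<in> Obj C"
        and "\<alpha> \<in> cls X Y ` Mor C X Y" "\<beta> \<in> cls Y Z ` Mor C Y Z"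
      then obtain f g where "\<alpha> = cls X Y f" "f \<in> Mor C X Y" "\<beta> = cls Y Z g" "g \<in> Mor C Y Z"
        by blast
      then show "on_mor \<Phi> X Z (Comp ?Q X Y Z \<beta> \<alpha>) =
          Comp D (on_obj F X) (on_obj F Y) (on_obj F Z) (on_mor \<Phi> Y Z \<beta>) (on_mor \<Phi> X Y \<alpha>)"
        using * by (simp only: CompQ C.comp_closed \<Phi>M FC)
    qed (auto simp: FO FM FI \<Phi>M C.ident_closed)
    show "bij_betw (on_mor \<Phi> X Y) (Mor ?Q X Y) (Mor D (on_obj \<Phi> X) (on_obj \<Phi> Y))"
      if "X \<in> Obj ?Q" "Y \<in> Obj ?Q" for X Y
      unfolding bij_betw_def MorQ \<Phi>O
    proof (intro conjI)
      have XY: "X \<in> Obj C" "Y \<in> Obj C" using that by auto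
      show "inj_on (on_mor \<Phi> X Y) (cls X Y ` Mor C X Y)"
        using XY by (auto simp: inj_on_def \<Phi>M cls_eq)
      have "on_mor \<Phi> X Y ` cls X Y ` Mor C X Y = on_mor F X Y ` Mor C X Y"
        using XY by (auto simp: image_image \<Phi>M)
      then show "on_mor \<Phi> X Y ` cls X Y ` Mor C X Y = Mor D (on_obj F X) (on_obj F Y)"
        using XY full[OF XY] FM by auto
    qed
    show "\<exists>X\<in>Obj ?Q. \<exists>h. is_iso D (on_obj \<Phi> X) N h" if "N \<in> Obj D" for N
      using dense[OF that] by (simp add: \<Phi>O)
  qed
qed

section \<open>The functor to the torsion-free class\<close>

lemma
  assumes "lw_cotorsion_pair K A \<C> \<T>"
  shows lw_cotorsion_pair_fd: "X \<in> \<C> \<Longrightarrow> X \<in> fd_modules K A"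
    and lw_cotorsion_pair_Ext1:
      "\<lbrakk>X \<in> \<C>; T \<in> \<T>\<rbrakk> \<Longrightarrow> Ext1 K A X T = {Ext1_zero K A X T}"
    and lw_cotorsion_pair_right_approximation:
      "M \<in> fd_modules K A \<Longrightarrow> \<exists>Y\<in>\<T>. \<exists>X\<in>\<C>. \<exists>j f.
        short_exact_seq A Y j X f M \<and> right_approximation A \<C> X M f"
  using assms by (simp_all add: lw_cotorsion_pair_def iso_closed_subcategory_def subset_iff)

locale torsion_free_quotients =
  fixes K :: "'k ring" and A :: "('k, 'a) module" and \<T> \<F> :: "('a, 'm) module set"
    and tor :: "('a, 'm) module \<Rightarrow> ('a, 'm) module" and incl :: "('a, 'm) module \<Rightarrow> 'm \<Rightarrow> 'm"
    and quot :: "('a, 'm) module \<Rightarrow> ('a, 'm) module" and proj :: "('a, 'm) module \<Rightarrow> 'm \<Rightarrow> 'm"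
  assumes algebra: "fd_algebra K A" and torsion_pair: "torsion_pair K A \<T> \<F>"
    and tor: "M \<in> fd_modules K A \<Longrightarrow> tor M \<in> \<T>"
    and quot: "M \<in> fd_modules K A \<Longrightarrow> quot M \<in> \<F>"
    and canonical:
      "M \<in> fd_modules K A \<Longrightarrow> short_exact_seq A (tor M) (incl M) M (proj M) (quot M)"
begin

lemmas left = fd_modulesD[of _ K A]

lemma
  assumes "M \<in> fd_modules K A"
  shows incl: "incl M \<in> Hom A (tor M) M" "inj_on (incl M) (carrier (tor M))"
    and proj: "proj M \<in> Hom A M (quot M)" "proj M ` carrier M = carrier (quot M)"
    and exact: "incl M ` carrier (tor M) = ker M (quot M) (proj M)"
    and tor_left: "left_module A (tor M)" and quot_left: "left_module A (quot M)"
    and tor_fd: "tor M \<in> fd_modules K A"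
  using canonical[OF assms] torsion_left_module[OF torsion_pair tor[OF assms]]
    torsion_free_left_module[OF torsion_pair quot[OF assms]] torsion_fd[OF torsion_pair tor[OF assms]]
  by (simp_all add: short_exact_seq_def right_exact_seq_def)

lemma torsion_map_in_ker_proj:
  assumes "M \<in> fd_modules K A" "T \<in> \<T>" "f \<in> Hom A T M" "t \<in> carrier T"
  shows "proj M (f t) = \<zero>\<^bsub>quot M\<^esub>"
  using Hom_torsion_torsion_free_eq_zero[OF torsion_pair assms(2) quot[OF assms(1)]
      compose_in_Hom[OF torsion_left_module[OF torsion_pair assms(2)] assms(3) proj(1)[OF assms(1)]]
      assms(4)] assms(4)
  by (simp add: compose_def)

lemma Hom_quot_eqI:
  assumes "M \<in> fd_modules K A" "h \<in> Hom A (quot M) N" "k \<in> Hom A (quot M) N"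
    and "\<And>x. x \<in> carrier M \<Longrightarrow> h (proj M x) = k (proj M x)"
  shows "h = k"
proof (rule Hom_eqI[OF assms(2,3)])
  fix y assume "y \<in> carrier (quot M)"
  then have "y \<in> proj M ` carrier M" using proj(2)[OF assms(1)] by simp
  then show "h y = k y" using assms(4) by blast
qed

text \<open>The universal property of \<open>quot M\<close>: torsion-free modules do not see \<open>tor M\<close>.\<close>

lemma factors_through_proj:
  assumes M: "M \<in> fd_modules K A" and F: "F \<in> \<F>" and f: "f \<in> Hom A M F"
  obtains h where "h \<in> Hom A (quot M) F" and "\<And>x. x \<in> carrier M \<Longrightarrow> h (proj M x) = f x"
proof -
  have Fl: "left_module A F" by (rule torsion_free_left_module[OF torsion_pair F])
  have "f (incl M t) = \<zero>\<^bsub>F\<^esub>" if "t \<in> carrier (tor M)" for t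
    using Hom_torsion_torsion_free_eq_zero[OF torsion_pair tor[OF M] F
        compose_in_Hom[OF tor_left[OF M] incl(1)[OF M] f] that] that
    by (simp add: compose_def)
  then have "ker M (quot M) (proj M) \<subseteq> ker M F f"
    unfolding exact[OF M, symmetric] using Hom_closed[OF incl(1)[OF M]] by (auto simp: ker_def)
  then show thesis
    using Hom_factors_through_surjection[OF left[OF M] quot_left[OF M] Fl proj[OF M] f] that
    by blast
qed

definition quot_map ::
    "('a, 'm) module \<Rightarrow> ('a, 'm) module \<Rightarrow> ('m \<Rightarrow> 'm) \<Rightarrow> 'm \<Rightarrow> 'm" where
  "quot_map X Y f =
     (THE h. h \<in> Hom A (quot X) (quot Y) \<and> (\<forall>x\<in>carrier X. h (proj X x) = proj Y (f x)))"

lemma quot_map_eqI: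
  assumes "X \<in> fd_modules K A" "h \<in> Hom A (quot X) (quot Y)"
    and "\<And>x. x \<in> carrier X \<Longrightarrow> h (proj X x) = proj Y (f x)"
  shows "quot_map X Y f = h"
  unfolding quot_map_def using assms by (intro the_equality) (auto intro: Hom_quot_eqI)

lemma
  assumes "X \<in> fd_modules K A" "Y \<in> fd_modules K A" "f \<in> Hom A X Y"
  shows quot_map_in_Hom: "quot_map X Y f \<in> Hom A (quot X) (quot Y)"
    and quot_map_proj: "x \<in> carrier X \<Longrightarrow> quot_map X Y f (proj X x) = proj Y (f x)"
proof -
  obtain h where h: "h \<in> Hom A (quot X) (quot Y)"
      "\<And>x. x \<in> carrier X \<Longrightarrow> h (proj X x) = proj Y (f x)"
    using factors_through_proj[OF assms(1) quot[OF assms(2)]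
        compose_in_Hom[OF left[OF assms(1)] assms(3) proj(1)[OF assms(2)]]]
    by (auto simp: compose_def)
  then have "quot_map X Y f = h" by (rule quot_map_eqI[OF assms(1)])
  then show "quot_map X Y f \<in> Hom A (quot X) (quot Y)"
    "x \<in> carrier X \<Longrightarrow> quot_map X Y f (proj X x) = proj Y (f x)" using h by simp_all
qed

definition quot_func ::
    "(('a, 'm) module, 'm \<Rightarrow> 'm, ('a, 'm) module, 'm \<Rightarrow> 'm) func" where
  "quot_func = \<lparr>on_obj = quot, on_mor = quot_map\<rparr>"

lemma quot_func_is_functor:
  assumes S: "S \<subseteq> fd_modules K A"
  shows "is_functor (full_subcat A S) (full_subcat A \<F>) quot_func"
proof -
  have fd: "X \<in> fd_modules K A" if "X \<in> S" for X using S that by blast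
  have ident: "quot_map X X (\<lambda>x\<in>carrier X. x) = (\<lambda>x\<in>carrier (quot X). x)" if X: "X \<in> S" for X
    using Hom_closed[OF proj(1)[OF fd[OF X]]]
    by (intro quot_map_eqI fd[OF X] id_in_Hom quot_left) simp
  have comp: "quot_map X Z (compose (carrier X) g f)
      = compose (carrier (quot X)) (quot_map Y Z g) (quot_map X Y f)"
    if X: "X \<in> S" and Y: "Y \<in> S" and Z: "Z \<in> S" and f: "f \<in> Hom A X Y" and g: "g \<in> Hom A Y Z"
    for X Y Z f g
  proof (rule quot_map_eqI[OF fd[OF X]])
    note XY = quot_map_in_Hom[OF fd[OF X] fd[OF Y] f] quot_map_proj[OF fd[OF X] fd[OF Y] f]
    note YZ = quot_map_in_Hom[OF fd[OF Y] fd[OF Z] g] quot_map_proj[OF fd[OF Y] fd[OF Z] g]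
    show "compose (carrier (quot X)) (quot_map Y Z g) (quot_map X Y f) \<in> Hom A (quot X) (quot Z)"
      by (rule compose_in_Hom[OF quot_left[OF fd[OF X]] XY(1) YZ(1)])
    fix x assume "x \<in> carrier X"
    then show "compose (carrier (quot X)) (quot_map Y Z g) (quot_map X Y f) (proj X x)
        = proj Z (compose (carrier X) g f x)"
      using Hom_closed[OF proj(1)[OF fd[OF X]]] Hom_closed[OF f] by (simp add: compose_def XY YZ)
  qed
  show ?thesis
    by (simp add: is_functor_def full_subcat_def quot_func_def fd quot quot_map_in_Hom ident comp)
qed

lemma quot_map_eq_iff:
  assumes X: "X \<in> fd_modules K A" and Y: "Y \<in> fd_modules K A"
    and f: "f \<in> Hom A X Y" and g: "g \<in> Hom A X Y"
  shows "quot_map X Y f = quot_map X Y g \<longleftrightarrow>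
    (\<forall>x\<in>carrier X. proj Y (f x \<ominus>\<^bsub>Y\<^esub> g x) = \<zero>\<^bsub>quot Y\<^esub>)"
proof -
  have "quot_map X Y f = quot_map X Y g \<longleftrightarrow> (\<forall>x\<in>carrier X. proj Y (f x) = proj Y (g x))"
    (is "?L = ?R")
  proof
    assume ?L
    then show ?R using quot_map_proj[OF X Y f] quot_map_proj[OF X Y g] by metis
  next
    assume ?R
    then show ?L
      using quot_map_proj[OF X Y f] quot_map_proj[OF X Y g]
      by (intro Hom_quot_eqI[OF X quot_map_in_Hom[OF X Y f] quot_map_in_Hom[OF X Y g]]) simp
  qed
  also have "\<dots> \<longleftrightarrow> (\<forall>x\<in>carrier X. f x \<ominus>\<^bsub>Y\<^esub> g x \<in> ker Y (quot Y) (proj Y))"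
    using Hom_eq_iff_minus_in_ker[OF left[OF Y] quot_left[OF Y] proj(1)[OF Y]]
      Hom_closed[OF f] Hom_closed[OF g] by simp
  also have "\<dots> \<longleftrightarrow> (\<forall>x\<in>carrier X. proj Y (f x \<ominus>\<^bsub>Y\<^esub> g x) = \<zero>\<^bsub>quot Y\<^esub>)"
  proof -
    interpret Y: left_module A Y by (rule left[OF Y])
    show ?thesis using Hom_closed[OF f] Hom_closed[OF g] by (simp add: ker_def)
  qed
  finally show ?thesis .
qed

text \<open>If \<open>d\<close> lands in \<open>tor Y\<close>, it factors through the right \<open>\<C>\<close>-approximation \<open>Z \<rightarrow> tor Y\<close> since its
  source is in \<open>\<C>\<close>.  The kernel of the approximation is in \<open>\<T>\<close>, so \<open>Z\<close> is an extension of torsion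
  modules, which puts it into \<open>\<C> \<inter> \<T>\<close>.\<close>

lemma factors_through_torsion_iff:
  assumes pair: "lw_cotorsion_pair K A \<C> \<T>" and X: "X \<in> \<C>" and Y: "Y \<in> fd_modules K A"
    and d: "d \<in> Hom A X Y"
  shows "d \<in> factor_through A (\<C> \<inter> \<T>) X Y \<longleftrightarrow> (\<forall>x\<in>carrier X. proj Y (d x) = \<zero>\<^bsub>quot Y\<^esub>)"
proof
  assume "d \<in> factor_through A (\<C> \<inter> \<T>) X Y"
  then obtain Z u v where Z: "Z \<in> \<T>" and u: "u \<in> Hom A X Z" and v: "v \<in> Hom A Z Y"
    and "d = compose (carrier X) v u"
    by (auto simp: factor_through_def)
  then show "\<forall>x\<in>carrier X. proj Y (d x) = \<zero>\<^bsub>quot Y\<^esub>"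
    using torsion_map_in_ker_proj[OF Y Z v] Hom_closed[OF u] by (simp add: compose_def)
next
  assume d0: "\<forall>x\<in>carrier X. proj Y (d x) = \<zero>\<^bsub>quot Y\<^esub>"
  have Xfd: "X \<in> fd_modules K A" by (rule lw_cotorsion_pair_fd[OF pair X])
  have "d ` carrier X \<subseteq> incl Y ` carrier (tor Y)"
    using d0 Hom_closed[OF d] by (auto simp: exact[OF Y] ker_def)
  then obtain u where u: "u \<in> Hom A X (tor Y)" "\<And>x. x \<in> carrier X \<Longrightarrow> incl Y (u x) = d x"
    using Hom_factors_through_injection[OF left[OF Xfd] tor_left[OF Y] incl[OF Y] d] by blast
  obtain S Z j f where S: "S \<in> \<T>" and ses: "short_exact_seq A S j Z f (tor Y)"
    and app: "right_approximation A \<C> Z (tor Y) f"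
    using lw_cotorsion_pair_right_approximation[OF pair tor_fd[OF Y]] by blast
  have Z: "Z \<in> \<C>" and f: "f \<in> Hom A Z (tor Y)" using app by (auto simp: right_approximation_def)
  have Zfd: "Z \<in> fd_modules K A" by (rule lw_cotorsion_pair_fd[OF pair Z])
  have "Z \<in> \<T>"
    by (rule torsion_closed_under_extensions[OF torsion_pair S tor[OF Y] Zfd ses])
  obtain w where w: "w \<in> Hom A X Z" "u = compose (carrier X) f w"
    using app X u(1) unfolding right_approximation_def by blast
  let ?v = "compose (carrier Z) (incl Y) f"
  have v: "?v \<in> Hom A Z Y" by (rule compose_in_Hom[OF left[OF Zfd] f incl(1)[OF Y]])
  have "d = compose (carrier X) ?v w"
  proof (rule Hom_eqI[OF d compose_in_Hom[OF left[OF Xfd] w(1) v]])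
    fix x assume x: "x \<in> carrier X"
    then show "d x = compose (carrier X) ?v w x"
      using u(2)[OF x] Hom_closed[OF w(1) x] by (simp add: w(2) compose_def)
  qed
  then show "d \<in> factor_through A (\<C> \<inter> \<T>) X Y"
    unfolding factor_through_def using Z \<open>Z \<in> \<T>\<close> w(1) v by blast
qed

text \<open>Hence morphisms are identified in \<open>\<C>/(\<C> \<inter> \<T>)\<close> exactly if \<open>quot_func\<close> identifies them.  In
  particular, the morphisms that factor through \<open>\<C> \<inter> \<T>\<close> form an ideal.\<close>

lemma factor_rel_eq_kernel:
  assumes pair: "lw_cotorsion_pair K A \<C> \<T>" and X: "X \<in> \<C>" and Y: "Y \<in> \<C>"
  shows "factor_rel A (\<C> \<inter> \<T>) X Y =
    {(f, g). f \<in> Hom A X Y \<and> g \<in> Hom A X Y \<and> quot_map X Y f = quot_map X Y g}"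
proof -
  have fd: "X \<in> fd_modules K A" "Y \<in> fd_modules K A"
    by (rule lw_cotorsion_pair_fd[OF pair X], rule lw_cotorsion_pair_fd[OF pair Y])
  have "(\<lambda>x\<in>carrier X. f x \<ominus>\<^bsub>Y\<^esub> g x) \<in> factor_through A (\<C> \<inter> \<T>) X Y \<longleftrightarrow>
      quot_map X Y f = quot_map X Y g"
    if "f \<in> Hom A X Y" "g \<in> Hom A X Y" for f g
    using factors_through_torsion_iff[OF pair X fd(2) minus_in_Hom[OF left[OF fd(1)] left[OF fd(2)] that]]
      quot_map_eq_iff[OF fd that] by simp
  then show ?thesis by (auto simp: factor_rel_def)
qed

text \<open>Fullness.  The obstruction to lifting \<open>X \<rightarrow> quot X \<rightarrow> quot Y\<close> along \<open>Y \<rightarrow> quot Y\<close> lies in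
  \<open>Ext\<^sup>1(X, tor Y)\<close>, which is zero for \<open>X\<close> in \<open>\<C>\<close>.\<close>

lemma quot_map_surj:
  assumes inf: "infinite (UNIV :: 'm set)" and pair: "lw_cotorsion_pair K A \<C> \<T>"
    and X: "X \<in> \<C>" and Y: "Y \<in> fd_modules K A"
  shows "Hom A (quot X) (quot Y) \<subseteq> quot_map X Y ` Hom A X Y"
proof
  fix h assume h: "h \<in> Hom A (quot X) (quot Y)"
  have Xfd: "X \<in> fd_modules K A" by (rule lw_cotorsion_pair_fd[OF pair X])
  have ext: "Ext1 K A X (tor Y) = {Ext1_zero K A X (tor Y)}"
    by (rule lw_cotorsion_pair_Ext1[OF pair X tor[OF Y]])
  obtain f where f: "f \<in> Hom A X Y"
      "\<And>x. x \<in> carrier X \<Longrightarrow> proj Y (f x) = compose (carrier X) h (proj X) x"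
    using lift_along_surjection_if_Ext1_trivial[OF algebra inf Xfd tor_fd[OF Y] left[OF Y]
        quot_left[OF Y] canonical[OF Y] ext compose_in_Hom[OF left[OF Xfd] proj(1)[OF Xfd] h]]
    by blast
  have "quot_map X Y f = h" by (rule quot_map_eqI[OF Xfd h]) (simp add: f(2) compose_def)
  then show "h \<in> quot_map X Y ` Hom A X Y" using f(1) by blast
qed

text \<open>The canonical sequence is unique: a surjection to a torsion-free module with torsion kernel has the
  universal property of \<open>quot X\<close>.  Applied to the right \<open>\<C>\<close>-approximation of \<open>F\<close>, this shows that
  every torsion-free module is isomorphic to some \<open>quot X\<close> with \<open>X\<close> in \<open>\<C>\<close>.\<close>

lemma quot_iso_if_torsion_kernel:
  assumes X: "X \<in> fd_modules K A" and F: "F \<in> \<F>" and T: "T \<in> \<T>"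
    and ses: "short_exact_seq A T j X f F"
  shows "\<exists>h. is_iso (full_subcat A \<F>) (quot X) F h"
proof -
  have Fl: "left_module A F" by (rule torsion_free_left_module[OF torsion_pair F])
  have j: "j \<in> Hom A T X" and f: "f \<in> Hom A X F" "f ` carrier X = carrier F"
    and ex: "j ` carrier T = ker X F f"
    using ses by (auto simp: short_exact_seq_def right_exact_seq_def)
  obtain h where h: "h \<in> Hom A (quot X) F" "\<And>x. x \<in> carrier X \<Longrightarrow> h (proj X x) = f x"
    using factors_through_proj[OF X F f(1)] by blast
  have "ker X F f \<subseteq> ker X (quot X) (proj X)"
    unfolding ex[symmetric] using torsion_map_in_ker_proj[OF X T j] Hom_closed[OF j]
    by (auto simp: ker_def)
  then obtain k where k: "k \<in> Hom A F (quot X)" "\<And>x. x \<in> carrier X \<Longrightarrow> k (f x) = proj X x"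
    using Hom_factors_through_surjection[OF left[OF X] Fl quot_left[OF X] f proj(1)[OF X]] by blast
  have "compose (carrier (quot X)) k h = (\<lambda>x\<in>carrier (quot X). x)"
    using Hom_closed[OF proj(1)[OF X]] h k
    by (intro Hom_quot_eqI[OF X compose_in_Hom[OF quot_left[OF X] h(1) k(1)]
          id_in_Hom[OF quot_left[OF X]]]) (simp add: compose_def)
  moreover have "compose (carrier F) h k = (\<lambda>x\<in>carrier F. x)"
  proof (rule Hom_eqI[OF compose_in_Hom[OF Fl k(1) h(1)] id_in_Hom[OF Fl]])
    fix y assume y: "y \<in> carrier F"
    then have "y \<in> f ` carrier X" using f(2) by simp
    then obtain x where "x \<in> carrier X" "y = f x" by blast
    then show "compose (carrier F) h k y = (\<lambda>x\<in>carrier F. x) y"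
      using y by (simp add: compose_def h(2) k(2))
  qed
  ultimately show ?thesis using h(1) k(1) by (auto simp: is_iso_def full_subcat_def)
qed

end

lemma infinite_if_lists_embed:
  fixes \<iota> :: "'k list \<Rightarrow> 'm"
  assumes "inj_on \<iota> (lists S)" "S \<noteq> {}"
  shows "infinite (UNIV :: 'm set)"
proof
  assume fin: "finite (UNIV :: 'm set)"
  obtain a where "a \<in> S" using assms(2) by blast
  then have "inj (\<lambda>n. \<iota> (replicate n a))"
    using assms(1) by (intro injI) (auto dest!: inj_onD dest: arg_cong[of _ _ length])
  then show False using fin finite_imageD[of _ "UNIV :: nat set"] by (meson finite_subset infinite_UNIV_nat subset_UNIV)
qed

theorem corollary0p5:
  fixes K :: "'k ring"
    and A :: "('k, 'a) module"
    and \<iota> :: "'k list \<Rightarrow> 'm"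
    and \<C> \<T> \<F> :: "('a, 'm) module set"
  assumes "fd_algebra K A"
    and "inj_on \<iota> (lists (carrier K))"
    and "lw_cotorsion_torsion_triple K A \<C> \<T> \<F>"
  shows "equivalent_categories (quotient_cat A \<C> (\<C> \<inter> \<T>)) (full_subcat A \<F>)"
proof -
  have pair: "lw_cotorsion_pair K A \<C> \<T>" and tp: "torsion_pair K A \<T> \<F>"
    using assms(3) unfolding lw_cotorsion_torsion_triple_def by blast+
  interpret fd_algebra K A by fact
  have inf: "infinite (UNIV :: 'm set)"
    using infinite_if_lists_embed[OF assms(2)] by blast
  have "\<forall>M. \<exists>T i Q p. M \<in> fd_modules K A \<longrightarrow> T \<in> \<T> \<and> Q \<in> \<F> \<and> short_exact_seq A T i M p Q"
    using canonical_torsion_sequence[OF assms(1) tp] by metis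
  then obtain tor incl quot proj where "\<And>M. M \<in> fd_modules K A \<Longrightarrow>
      tor M \<in> \<T> \<and> quot M \<in> \<F> \<and> short_exact_seq A (tor M) (incl M) M (proj M) (quot M)"
    by metis
  then interpret torsion_free_quotients K A \<T> \<F> tor incl quot proj
    using assms(1) tp by unfold_locales auto
  have C: "\<C> \<subseteq> fd_modules K A"
    using lw_cotorsion_pair_fd[OF pair] by blast
  have F: "\<F> \<subseteq> fd_modules K A" using torsion_free_fd[OF tp] by blast
  have dense: "\<exists>X\<in>\<C>. \<exists>h. is_iso (full_subcat A \<F>) (on_obj quot_func X) N h" if N: "N \<in> \<F>" for N
  proof -
    obtain T X j f where TX: "T \<in> \<T>" "X \<in> \<C>" and ses: "short_exact_seq A T j X f N"
      using lw_cotorsion_pair_right_approximation[OF pair] N F by blast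
    then have "\<exists>h. is_iso (full_subcat A \<F>) (on_obj quot_func X) N h"
      using quot_iso_if_torsion_kernel[OF _ N TX(1) ses] C by (auto simp: quot_func_def)
    then show ?thesis using TX(2) by blast
  qed
  have "equivalent_categories
      \<lparr>Obj = Obj (full_subcat A \<C>),
       Mor = (\<lambda>X Y. Mor (full_subcat A \<C>) X Y // factor_rel A (\<C> \<inter> \<T>) X Y),
       Ident = (\<lambda>X. factor_rel A (\<C> \<inter> \<T>) X X `` {Ident (full_subcat A \<C>) X}),
       Comp = (\<lambda>X Y Z \<beta> \<alpha>. \<Union>g\<in>\<beta>. \<Union>f\<in>\<alpha>.
          factor_rel A (\<C> \<inter> \<T>) X Z `` {Comp (full_subcat A \<C>) X Y Z g f})\<rparr>
      (full_subcat A \<F>)"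
  proof (rule equivalent_if_quotient_by_kernel[OF category_full_subcat[OF C]
        category_full_subcat[OF F] quot_func_is_functor[OF C]])
    show "Mor (full_subcat A \<F>) (on_obj quot_func X) (on_obj quot_func Y)
        \<subseteq> on_mor quot_func X Y ` Mor (full_subcat A \<C>) X Y"
      if "X \<in> Obj (full_subcat A \<C>)" "Y \<in> Obj (full_subcat A \<C>)" for X Y
      using quot_map_surj[OF inf pair, of X Y] that C by (auto simp: full_subcat_def quot_func_def)
    show "factor_rel A (\<C> \<inter> \<T>) X Y = {(f, g). f \<in> Mor (full_subcat A \<C>) X Y \<and>
        g \<in> Mor (full_subcat A \<C>) X Y \<and> on_mor quot_func X Y f = on_mor quot_func X Y g}"
      if "X \<in> Obj (full_subcat A \<C>)" "Y \<in> Obj (full_subcat A \<C>)" for X Y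
      using factor_rel_eq_kernel[OF pair, of X Y] that by (simp add: full_subcat_def quot_func_def)
  qed (use dense in \<open>simp add: full_subcat_def\<close>)
  then show ?thesis by (simp add: full_subcat_def quotient_cat_def)
qed

end
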